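(* Let $d,n\ge 1$ be integers, let $K_1,\ldots,K_n\in(0,\infty)$, and let $X_1,\ldots,X_n$ be independent random vectors in $\mathbb{R}^d$ with $M(X_i)\le K_i$ for each $i$. Let $U_1,\ldots,U_n$ be independent random vectors in $\mathbb{R}^d$ such that $U_i$ has density equal to $K_i$ on a ball centered at the origin (necessarily of Lebesgue measure $1/K_i$) and equal to $0$ elsewhere. Then $$M(X_1+\cdots+X_n)\le M(U_1+\cdots+U_n).$$
   Context: $\mu$ denotes Lebesgue measure on $\mathbb{R}^d$, and balls are Euclidean. For a random vector $X$ in $\mathbb{R}^d$ with a density $p$ with respect to $\mu$, $M(X)=\operatorname{ess\,sup} p:=\sup\{\epsilon:\mu(\{t:p(t)>\epsilon\})>0\}$. If the distribution of $X$ is not absolutely continuous with respect to $\mu$, then $M(X):=\infty$. *)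

theory Defs
  imports "HOL-Probability.Probability" "HOL-Probability.Essential_Supremum"
begin

text \<open>
  The levels \<open>e\<close> range over \<^typ>\<open>ennreal\<close>; as densities are nonnegative this yields the same
  supremum as letting them range over the reals. Any other version of the density may replace
  the Radon--Nikodym derivative, see \<open>ess_sup_density_eq\<close> below.
\<close>

definition ess_sup_density :: "'a measure \<Rightarrow> ('a \<Rightarrow> 'b::euclidean_space) \<Rightarrow> ennreal" where
  "ess_sup_density P X =
    (if absolutely_continuous lborel (distr P borel X)
     then Sup {e. emeasure lborel {t. RN_deriv lborel (distr P borel X) t > e} > 0}
     else \<infinity>)"

lemma Sup_levels_eq_esssup:
  fixes p :: "'b::euclidean_space \<Rightarrow> ennreal"
  assumes [measurable]: "p \<in> borel_measurable lborel"
  shows "Sup {e. emeasure lborel {t. p t > e} > 0} = esssup lborel p"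
proof -
  have iff: "emeasure lborel {t. p t > e} = 0 \<longleftrightarrow> esssup lborel p \<le> e" for e
  proof
    assume "emeasure lborel {t. p t > e} = 0"
    then show "esssup lborel p \<le> e"
      by (subst esssup_eq[OF assms]) (auto intro!: Inf_lower)
  next
    assume le: "esssup lborel p \<le> e"
    have "emeasure lborel {t. p t > e} \<le> emeasure lborel {t \<in> space lborel. p t > esssup lborel p}"
      using le by (intro emeasure_mono) auto
    then show "emeasure lborel {t. p t > e} = 0"
      by (simp only: esssup_zero_measure le_zero_eq)
  qed
  have "emeasure lborel {t. p t > e} > 0 \<longleftrightarrow> e < esssup lborel p" for e
    using iff[of e] by (metis not_gr_zero not_le)
  then have "{e. emeasure lborel {t. p t > e} > 0} = {..<esssup lborel p}"
    by auto
  then show ?thesis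
    by (simp add: Sup_lessThan)
qed

lemma ess_sup_density_eq:
  fixes X :: "'a \<Rightarrow> 'b::euclidean_space"
  assumes "distributed P lborel X p"
  shows "ess_sup_density P X = Sup {e. emeasure lborel {t. p t > e} > 0}"
proof -
  have p [measurable]: "p \<in> borel_measurable lborel"
    using assms by (auto simp: distributed_def)
  have "distr P borel X = distr P lborel X"
    by (rule distr_cong) auto
  then have d: "distr P borel X = density lborel p"
    using assms by (auto simp: distributed_def)
  have ac: "absolutely_continuous lborel (distr P borel X)"
    unfolding d by (rule absolutely_continuousI_density) (rule p)
  have ae: "AE t in lborel. RN_deriv lborel (distr P borel X) t = p t"
    using sigma_finite_measure.RN_deriv_unique[OF lborel.sigma_finite_measure_axioms p d[symmetric]]
    by (rule eventually_mono) simp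
  have "emeasure lborel {t. RN_deriv lborel (distr P borel X) t > e}
      = emeasure lborel {t. p t > e}" for e
    by (rule emeasure_eq_AE) (use ae in \<open>auto elim!: eventually_mono\<close>)
  then show ?thesis
    using ac by (simp add: ess_sup_density_def)
qed

end

theory Submission
  imports Defs
begin

text \<open>
  For a set \<open>A\<close> of finite volume let \<open>A*\<close> be the open ball about the origin with the same volume
  (\<open>rearr A\<close> below).
  A density \<open>p\<close> is compared with a radially decreasing function \<open>q\<close> by requiring
  \<open>\<integral>\<^sub>D p \<le> \<integral>\<^sub>D\<^sub>* q\<close> for every set \<open>D\<close> of finite volume (\<open>less_spread\<close>). If \<open>X\<^sub>i\<close> has a
  density bounded by \<open>K\<^sub>i\<close>, then this density is comparable in this sense with the uniform density of
  \<open>U\<^sub>i\<close>, since both \<open>1\<close> and \<open>K\<^sub>i \<bar>D\<bar>\<close> bound \<open>\<integral>\<^sub>D p\<close> (\<open>less_spread_bounded\<close>). The relation is preserved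
  by convolution (\<open>less_spread_conv\<close>), hence passes to the densities of the two sums, and it implies
  the inequality between essential suprema: integrate over a bounded piece of \<open>{p > e}\<close>
  (\<open>less_spread_levels\<close>).

  Stability under convolution is where the geometry enters. Slicing all functions into level sets
  (\<open>less_spread_pairing\<close>) reduces it to indicator functions, that is, to the Riesz rearrangement
  inequality for the measure of \<open>{(x, y). x \<in> A \<and> y \<in> B \<and> x + y \<in> C}\<close>
  (\<open>riesz_rearrangement\<close>). On the line, the Riesz inequality follows from a bound in the spirit of
  Pollard's theorem: if an initial piece of \<open>A\<close> and a final piece of \<open>B\<close>, both of measure \<open>t\<close>, are
  cut off, then the pairs \<open>(x, y)\<close> with \<open>x\<close> in the first or \<open>y\<close> in the second piece represent each
  sum \<open>z\<close> at most \<open>t\<close> times, because both conditions on \<open>x\<close> are upper bounds and the weaker one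
  decides (\<open>riesz_form_cut_bound\<close>). In higher dimensions the inequality on the line shows that Steiner
  symmetrization in any direction increases the functional, and suitably chosen symmetrizations
  bring the three sets simultaneously close to balls. For this last point no compactness is needed:
  averaging over all translations yields a direction whose symmetrization reduces the defect
  \<open>m = \<bar>A - A*\<bar>\<close> by at least a fixed multiple of \<open>m\<^sup>2\<close> (\<open>steiner_gain\<close>).
\<close>

section \<open>The three-set functional\<close>

lemma nn_integral_lborel_plus:
  fixes f :: "'a::euclidean_space \<Rightarrow> ennreal"
  assumes [measurable]: "f \<in> borel_measurable borel"
  shows "(\<integral>\<^sup>+x. f (c + x) \<partial>lborel) = (\<integral>\<^sup>+x. f x \<partial>lborel)"
proof -
  have "(\<integral>\<^sup>+x. f x \<partial>lborel) = (\<integral>\<^sup>+x. f x \<partial>distr lborel borel ((+) c))"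
    by (simp add: lborel_distr_plus)
  also have "\<dots> = (\<integral>\<^sup>+x. f (c + x) \<partial>lborel)"
    by (subst nn_integral_distr) auto
  finally show ?thesis ..
qed

lemma nn_integral_lborel_minus:
  fixes f :: "'a::euclidean_space \<Rightarrow> ennreal"
  assumes [measurable]: "f \<in> borel_measurable borel"
  shows "(\<integral>\<^sup>+x. f (c - x) \<partial>lborel) = (\<integral>\<^sup>+x. f x \<partial>lborel)"
proof -
  have "lborel = density (distr lborel borel (\<lambda>x::'a. c + (-1) *\<^sub>R x)) (\<lambda>_. ennreal (\<bar>-1\<bar>^DIM('a)))"
    by (rule lborel_affine) simp
  then have "(lborel::'a measure) = distr lborel borel (\<lambda>x::'a. c - x)"
    by (simp add: density_1)
  then have "(\<integral>\<^sup>+x. f x \<partial>lborel) = (\<integral>\<^sup>+x. f x \<partial>distr lborel borel (\<lambda>x::'a. c - x))"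
    by simp
  also have "\<dots> = (\<integral>\<^sup>+x. f (c - x) \<partial>lborel)"
    by (subst nn_integral_distr) auto
  finally show ?thesis ..
qed

text \<open>
  The measure of \<open>{(x, y). x \<in> A \<and> y \<in> B \<and> x + y \<in> C}\<close>, a trilinear functional of the indicators.
\<close>

definition riesz_form :: "'a::euclidean_space set \<Rightarrow> 'a set \<Rightarrow> 'a set \<Rightarrow> ennreal" where
  "riesz_form A B C = (\<integral>\<^sup>+x. \<integral>\<^sup>+y. indicator A x * indicator B y * indicator C (x + y) \<partial>lborel \<partial>lborel)"

lemma riesz_form_eq:
  assumes [measurable]: "A \<in> sets borel" "B \<in> sets borel" "C \<in> sets borel"
  shows "riesz_form A B C = (\<integral>\<^sup>+z. \<integral>\<^sup>+x. indicator A x * indicator B (z - x) * indicator C z \<partial>lborel \<partial>lborel)"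
proof -
  have "(\<integral>\<^sup>+y. indicator A x * indicator B y * indicator C (x + y) \<partial>lborel) =
     (\<integral>\<^sup>+z. indicator A x * indicator B (z - x) * indicator C z \<partial>lborel :: ennreal)" for x
    using nn_integral_lborel_plus[of "\<lambda>z. indicator A x * indicator B (z - x) * indicator C z" x]
    by simp
  then have "riesz_form A B C = (\<integral>\<^sup>+x. \<integral>\<^sup>+z. indicator A x * indicator B (z - x) * indicator C z \<partial>lborel \<partial>lborel)"
    by (simp add: riesz_form_def)
  also have "\<dots> = (\<integral>\<^sup>+z. \<integral>\<^sup>+x. indicator A x * indicator B (z - x) * indicator C z \<partial>lborel \<partial>lborel)"
    by (rule lborel_pair.Fubini') measurable
  finally show ?thesis .
qed

lemma riesz_form_commute:
  assumes [measurable]: "A \<in> sets borel" "B \<in> sets borel" "C \<in> sets borel"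
  shows "riesz_form A B C = riesz_form B A C"
  unfolding riesz_form_def
  by (subst lborel_pair.Fubini') (auto simp: ac_simps intro!: nn_integral_cong)

lemma emeasure_minus_vimage:
  assumes [measurable]: "B \<in> sets borel"
  shows "(\<integral>\<^sup>+x. indicator B (z - x) \<partial>lborel) = emeasure lborel B"
  using nn_integral_lborel_minus[of "indicator B" z] by simp

lemma riesz_form_le12:
  assumes [measurable]: "A \<in> sets borel" "B \<in> sets borel" "C \<in> sets borel"
  shows "riesz_form A B C \<le> emeasure lborel A * emeasure lborel B"
proof -
  have "riesz_form A B C \<le> (\<integral>\<^sup>+x. \<integral>\<^sup>+y. indicator A x * indicator B y \<partial>lborel \<partial>lborel)"
    unfolding riesz_form_def by (intro nn_integral_mono) (auto split: split_indicator)
  also have "\<dots> = emeasure lborel A * emeasure lborel B"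
    by (simp add: nn_integral_cmult nn_integral_multc)
  finally show ?thesis .
qed

lemma riesz_form_le13:
  assumes [measurable]: "A \<in> sets borel" "B \<in> sets borel" "C \<in> sets borel"
  shows "riesz_form A B C \<le> emeasure lborel A * emeasure lborel C"
proof -
  have "riesz_form A B C \<le> (\<integral>\<^sup>+z. \<integral>\<^sup>+x. indicator A x * indicator C z \<partial>lborel \<partial>lborel)"
    unfolding riesz_form_eq[OF assms] by (intro nn_integral_mono) (auto split: split_indicator)
  also have "\<dots> = emeasure lborel A * emeasure lborel C"
    by (simp add: nn_integral_cmult nn_integral_multc)
  finally show ?thesis .
qed

lemma riesz_form_le23:
  assumes [measurable]: "A \<in> sets borel" "B \<in> sets borel" "C \<in> sets borel"
  shows "riesz_form A B C \<le> emeasure lborel B * emeasure lborel C"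
  using riesz_form_le13[of B A C] riesz_form_commute[of A B C] by simp

section \<open>The Riesz inequality on the line\<close>

lemma cut_set:
  fixes A :: "real set"
  assumes [measurable]: "A \<in> sets borel" and bd: "A \<subseteq> {-R..R}" and R: "R \<ge> 0"
    and t: "0 \<le> t" "ennreal t \<le> emeasure lborel A"
  obtains x0 where "emeasure lborel (A \<inter> {..x0}) = ennreal t"
proof -
  have fin: "emeasure lborel A < \<infinity>"
    using emeasure_mono[OF bd, of lborel] R by (simp add: le_less_trans)
  define F where "F x = measure lborel (A \<inter> {..x})" for x
  have em: "emeasure lborel (A \<inter> {..x}) = ennreal (F x)" for x
    unfolding F_def
    by (rule emeasure_eq_ennreal_measure)
      (use fin emeasure_mono[of "A \<inter> {..x}" A lborel] in \<open>auto simp: top_unique\<close>)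
  have lip: "F y \<le> F x + (y - x)" if "x \<le> y" for x y
  proof -
    have "ennreal (F y) \<le> emeasure lborel ((A \<inter> {..x}) \<union> {x..y})"
      unfolding em[symmetric] by (intro emeasure_mono) auto
    also have "\<dots> \<le> emeasure lborel (A \<inter> {..x}) + emeasure lborel {x..y}"
      by (intro emeasure_subadditive) auto
    also have "\<dots> = ennreal (F x + (y - x))"
      using that by (simp add: em ennreal_plus F_def)
    finally show ?thesis
      using that by (subst (asm) ennreal_le_iff) (auto simp: F_def)
  qed
  have mono: "F x \<le> F y" if "x \<le> y" for x y
  proof -
    have "ennreal (F x) \<le> ennreal (F y)"
      unfolding em[symmetric] using that by (intro emeasure_mono) auto
    then show ?thesis by (simp add: F_def)
  qed
  have "\<bar>F x - F y\<bar> \<le> \<bar>x - y\<bar>" for x y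
    using lip[of x y] lip[of y x] mono[of x y] mono[of y x] by linarith
  then have cont: "continuous_on S F" for S
    by (intro lipschitz_on_continuous_on[of 1] lipschitz_onI) (auto simp: dist_real_def)
  have "A \<inter> {..-R-1} = {}" "A \<inter> {..R} = A" using bd by auto
  then have "F (-R-1) = 0" "ennreal (F R) = emeasure lborel A"
    using em[of R] by (auto simp: F_def)
  then have "F (-R-1) \<le> t" "t \<le> F R"
    using t ennreal_le_iff[of "F R" t] by (auto simp: F_def)
  then have "\<exists>x\<ge>-R-1. x \<le> R \<and> F x = t"
    using R by (intro IVT' cont) auto
  then show ?thesis
    using em that by auto
qed

text \<open>
  If none of the three measures exceeds the sum of the other two, then the bound with
  \<open>t = (\<bar>A\<bar> + \<bar>B\<bar> - \<bar>C\<bar>) / 2\<close> is sharp: it is attained by centred intervals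
  (\<open>riesz_form_cint_ge\<close>).
\<close>

lemma riesz_form_cut_bound:
  fixes A B C :: "real set"
  assumes [measurable]: "A \<in> sets borel" "B \<in> sets borel" "C \<in> sets borel"
    and bd: "A \<subseteq> {-R..R}" "B \<subseteq> {-R..R}" and R: "R \<ge> 0"
    and ab: "emeasure lborel A = ennreal a" "emeasure lborel B = ennreal b"
    and t: "0 \<le> t" "t \<le> a" "t \<le> b"
  shows "riesz_form A B C \<le> ennreal t * emeasure lborel C + ennreal ((a - t) * (b - t))"
proof -
  obtain x0 where x0: "emeasure lborel (A \<inter> {..x0}) = ennreal t"
    using cut_set[OF _ bd(1) R, of t] t ab by (auto intro: ennreal_leI)
  obtain y0 where y0: "emeasure lborel (B \<inter> {..y0}) = ennreal (b - t)"
    using cut_set[OF _ bd(2) R, of "b - t"] t ab by (auto intro: ennreal_leI)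
  have A': "emeasure lborel (A \<inter> {x0<..}) = ennreal (a - t)"
  proof -
    have "A \<inter> {x0<..} = A - A \<inter> {..x0}" by auto
    then show ?thesis
      using x0 ab t by (simp add: emeasure_Diff ennreal_minus)
  qed
  have B': "emeasure lborel (B \<inter> {y0<..}) = ennreal t"
  proof -
    have "B \<inter> {y0<..} = B - B \<inter> {..y0}" by auto
    then show ?thesis
      using y0 ab t by (simp add: emeasure_Diff ennreal_minus)
  qed
  define G where "G = {(x, y). x \<le> x0 \<or> y > y0}"
  have [measurable]: "G \<in> sets (borel \<Otimes>\<^sub>M borel)"
  proof -
    have "{p \<in> space (borel \<Otimes>\<^sub>M borel). fst p \<le> x0 \<or> snd p > y0} \<in> sets (borel \<Otimes>\<^sub>M borel)"
      by measurable
    then show ?thesis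
      by (simp add: G_def space_pair_measure case_prod_beta')
  qed
  \<comment> \<open>Both conditions in \<open>G\<close> bound \<open>x\<close> from above, so on the fibre over \<open>z\<close> one of them
    implies the other.\<close>
  have inner: "(\<integral>\<^sup>+x. indicator A x * indicator B (z - x) * indicator G (x, z - x) \<partial>lborel) \<le> ennreal t" for z
  proof (cases "x0 \<ge> z - y0")
    case True
    have "(\<integral>\<^sup>+x. indicator A x * indicator B (z - x) * indicator G (x, z - x) \<partial>lborel)
       \<le> (\<integral>\<^sup>+x. indicator (A \<inter> {..x0}) x \<partial>lborel)"
      using True by (intro nn_integral_mono) (auto simp: G_def split: split_indicator)
    then show ?thesis using x0 by simp
  next
    case False
    have "(\<integral>\<^sup>+x. indicator A x * indicator B (z - x) * indicator G (x, z - x) \<partial>lborel)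
       \<le> (\<integral>\<^sup>+x. indicator (B \<inter> {y0<..}) (z - x) \<partial>lborel)"
      using False by (intro nn_integral_mono) (auto simp: G_def split: split_indicator)
    then show ?thesis using B' by (simp add: emeasure_minus_vimage)
  qed
  have "riesz_form A B C \<le> (\<integral>\<^sup>+z. \<integral>\<^sup>+x. indicator (A \<inter> {x0<..}) x * indicator (B \<inter> {..y0}) (z - x) +
      indicator C z * (indicator A x * indicator B (z - x) * indicator G (x, z - x)) \<partial>lborel \<partial>lborel)"
    unfolding riesz_form_eq[OF assms(1-3)]
    by (intro nn_integral_mono) (auto simp: G_def split: split_indicator)
  also have "\<dots> = (\<integral>\<^sup>+z. \<integral>\<^sup>+x. indicator (A \<inter> {x0<..}) x * indicator (B \<inter> {..y0}) (z - x) \<partial>lborel \<partial>lborel)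
      + (\<integral>\<^sup>+z. indicator C z * (\<integral>\<^sup>+x. indicator A x * indicator B (z - x) * indicator G (x, z - x) \<partial>lborel) \<partial>lborel)"
    by (simp add: nn_integral_add nn_integral_cmult)
  also have "(\<integral>\<^sup>+z. \<integral>\<^sup>+x. indicator (A \<inter> {x0<..}) x * indicator (B \<inter> {..y0}) (z - x) \<partial>lborel \<partial>lborel)
     = riesz_form (A \<inter> {x0<..}) (B \<inter> {..y0}) UNIV"
    by (simp add: riesz_form_eq)
  also have "\<dots> \<le> ennreal ((a - t) * (b - t))"
    using riesz_form_le12[of "A \<inter> {x0<..}" "B \<inter> {..y0}" UNIV] A' y0 t by (simp add: ennreal_mult)
  also have "(\<integral>\<^sup>+z. indicator C z * (\<integral>\<^sup>+x. indicator A x * indicator B (z - x) * indicator G (x, z - x) \<partial>lborel) \<partial>lborel)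
     \<le> (\<integral>\<^sup>+z. indicator C z * ennreal t \<partial>lborel)"
    by (intro nn_integral_mono mult_left_mono inner) auto
  also have "\<dots> = ennreal t * emeasure lborel C"
    by (simp add: nn_integral_multc mult.commute[of _ "ennreal t"] nn_integral_cmult)
  finally show ?thesis
    by (simp add: add_mono add.commute)
qed

text \<open>
  The open interval of length \<open>a\<close> about the origin.
\<close>

abbreviation cint :: "real \<Rightarrow> real set" where
  "cint a \<equiv> {-(a/2)<..<a/2}"

lemma riesz_form_cint_ge:
  assumes "0 \<le> a" "0 \<le> b" "0 \<le> c" "c \<le> a + b" "a \<le> b + c" "b \<le> a + c"
  defines "t \<equiv> (a + b - c) / 2"
  shows "ennreal t * ennreal c + ennreal ((a - t) * (b - t)) \<le> riesz_form (cint a) (cint b) (cint c)"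
proof -
  define x0 y0 where "x0 = -(a/2) + t" and "y0 = b/2 - t"
  have t: "0 \<le> t" "t \<le> a" "t \<le> b" "a + b - 2 * t = c"
    using assms by (auto simp: t_def field_simps)
  define m where "m z = max x0 (z - y0)" for z
  have [measurable]: "m \<in> borel_measurable borel" unfolding m_def by measurable
  have "riesz_form {x0<..<a/2} {-(b/2)<..<y0} UNIV = ennreal ((a - t) * (b - t))"
  proof -
    have "emeasure lborel {x0<..<a/2} = ennreal (a - t)" "emeasure lborel {-(b/2)<..<y0} = ennreal (b - t)"
      using t by (auto simp: x0_def y0_def)
    then show ?thesis
      using t by (simp add: riesz_form_def nn_integral_cmult nn_integral_multc ennreal_mult)
  qed
  then have 1: "(\<integral>\<^sup>+z. \<integral>\<^sup>+x. indicator {x0<..<a/2} x * indicator {-(b/2)<..<y0} (z - x) \<partial>lborel \<partial>lborel)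
     = ennreal ((a - t) * (b - t))"
    by (simp add: riesz_form_eq)
  have 2: "(\<integral>\<^sup>+z. \<integral>\<^sup>+x. indicator (cint c) z * indicator {m z - t<..<m z} x \<partial>lborel \<partial>lborel)
      = ennreal t * ennreal c"
    using t assms(3) by (simp add: nn_integral_cmult nn_integral_multc mult.commute)
  \<comment> \<open>The same cuts as in the upper bound: every sum in \<open>cint c\<close> is represented on an interval of
    length \<open>t\<close>, and all sums of the two remaining intervals lie in \<open>cint c\<close>.\<close>
  have *: "indicator {x0<..<a/2} x * indicator {-(b/2)<..<y0} (z - x)
      + indicator (cint c) z * indicator {m z - t<..<m z} x
      \<le> (indicator (cint a) x * indicator (cint b) (z - x) * indicator (cint c) z :: ennreal)" for x z
  proof -
    define p1 p2 p3 where "p1 \<longleftrightarrow> x0 < x \<and> x < a/2 \<and> -(b/2) < z - x \<and> z - x < y0"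
      and "p2 \<longleftrightarrow> z \<in> cint c \<and> m z - t < x \<and> x < m z"
      and "p3 \<longleftrightarrow> x \<in> cint a \<and> z - x \<in> cint b \<and> z \<in> cint c"
    have "\<not> (p1 \<and> p2)"
      by (auto simp: p1_def p2_def m_def)
    moreover have "p1 \<Longrightarrow> p3"
      using t unfolding p1_def p3_def x0_def y0_def by auto
    moreover have "p2 \<Longrightarrow> p3"
      using t unfolding p2_def p3_def x0_def y0_def m_def by (auto simp: max_def split: if_splits)
    moreover have e: "indicator {x0<..<a/2} x * indicator {-(b/2)<..<y0} (z - x) = (of_bool p1 :: ennreal)"
      "indicator (cint c) z * indicator {m z - t<..<m z} x = (of_bool p2 :: ennreal)"
      "indicator (cint a) x * indicator (cint b) (z - x) * indicator (cint c) z = (of_bool p3 :: ennreal)"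
      by (simp_all add: p1_def p2_def p3_def indicator_def)
    ultimately show ?thesis
      unfolding e by (cases p1; cases p2) simp_all
  qed
  have [measurable]: "Measurable.pred (borel \<Otimes>\<^sub>M borel) (\<lambda>p. snd p \<in> {m (fst p) - t<..<m (fst p)})"
    unfolding greaterThanLessThan_iff by measurable
  have "ennreal t * ennreal c + ennreal ((a - t) * (b - t)) =
    (\<integral>\<^sup>+z. \<integral>\<^sup>+x. indicator {x0<..<a/2} x * indicator {-(b/2)<..<y0} (z - x)
      + indicator (cint c) z * indicator {m z - t<..<m z} x \<partial>lborel \<partial>lborel)"
  proof -
    have "(\<integral>\<^sup>+x. indicator {x0<..<a/2} x * indicator {-(b/2)<..<y0} (z - x)
      + indicator (cint c) z * indicator {m z - t<..<m z} x \<partial>lborel) =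
      (\<integral>\<^sup>+x. indicator {x0<..<a/2} x * indicator {-(b/2)<..<y0} (z - x) \<partial>lborel) +
      (\<integral>\<^sup>+x. indicator (cint c) z * indicator {m z - t<..<m z} x \<partial>lborel :: ennreal)" for z
      by (rule nn_integral_add) measurable
    moreover have "(\<integral>\<^sup>+z. (\<integral>\<^sup>+x. indicator {x0<..<a/2} x * indicator {-(b/2)<..<y0} (z - x) \<partial>lborel) +
      (\<integral>\<^sup>+x. indicator (cint c) z * indicator {m z - t<..<m z} x \<partial>lborel) \<partial>lborel) =
      ennreal ((a - t) * (b - t)) + ennreal t * ennreal c"
      unfolding 1[symmetric] 2[symmetric] by (rule nn_integral_add) measurable
    ultimately show ?thesis
      by (simp only: add.commute)
  qed
  also have "\<dots> \<le> riesz_form (cint a) (cint b) (cint c)"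
    by (subst riesz_form_eq) (simp_all add: nn_integral_mono *)
  finally show ?thesis .
qed

lemma riesz_form_cint_long_third:
  assumes "0 \<le> a" "0 \<le> b" "a + b \<le> c"
  shows "riesz_form (cint a) (cint b) (cint c) = ennreal a * ennreal b"
proof -
  have "riesz_form (cint a) (cint b) (cint c) = (\<integral>\<^sup>+x. \<integral>\<^sup>+y. indicator (cint a) x * indicator (cint b) y \<partial>lborel \<partial>lborel)"
    unfolding riesz_form_def using assms
    by (intro nn_integral_cong) (auto split: split_indicator)
  then show ?thesis
    using assms by (simp add: nn_integral_cmult nn_integral_multc)
qed

lemma riesz_form_cint_long_first:
  assumes "0 \<le> b" "0 \<le> c" "b + c \<le> a"
  shows "riesz_form (cint a) (cint b) (cint c) = ennreal b * ennreal c"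
proof -
  have "riesz_form (cint a) (cint b) (cint c) = (\<integral>\<^sup>+z. \<integral>\<^sup>+x. indicator (cint b) (z - x) * indicator (cint c) z \<partial>lborel \<partial>lborel)"
    using assms by (subst riesz_form_eq)
     (auto split: split_indicator intro!: nn_integral_cong)
  then show ?thesis
    using assms by (simp add: nn_integral_cmult nn_integral_multc emeasure_minus_vimage)
qed

text \<open>
  In the first three cases the bound is one of the trivial ones and holds with equality for centred
  intervals.
\<close>

theorem riesz_real:
  fixes A B C :: "real set"
  assumes [measurable]: "A \<in> sets borel" "B \<in> sets borel" "C \<in> sets borel"
    and bd: "A \<subseteq> {-R..R}" "B \<subseteq> {-R..R}"
    and m: "emeasure lborel A = ennreal a" "emeasure lborel B = ennreal b" "emeasure lborel C = ennreal c"
    and nn: "0 \<le> a" "0 \<le> b" "0 \<le> c"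
  shows "riesz_form A B C \<le> riesz_form (cint a) (cint b) (cint c)"
proof -
  consider "a + b \<le> c" | "b + c \<le> a" | "a + c \<le> b" | "c \<le> a + b" "a \<le> b + c" "b \<le> a + c"
    by linarith
  then show ?thesis
  proof cases
    case 1
    then show ?thesis using riesz_form_le12[of A B C] riesz_form_cint_long_third[of a b c] nn m by simp
  next
    case 2
    then show ?thesis using riesz_form_le23[of A B C] riesz_form_cint_long_first[of b c a] nn m by simp
  next
    case 3
    then show ?thesis
      using riesz_form_le13[of A B C] riesz_form_cint_long_first[of a c b] riesz_form_commute[of "cint a" "cint b" "cint c"] nn m
      by simp
  next
    case 4
    have "A \<subseteq> {-\<bar>R\<bar>..\<bar>R\<bar>}" "B \<subseteq> {-\<bar>R\<bar>..\<bar>R\<bar>}" using bd by force+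
    then have "riesz_form A B C \<le> ennreal ((a+b-c)/2) * ennreal c + ennreal ((a - (a+b-c)/2) * (b - (a+b-c)/2))"
      using 4 nn m(3) by (intro riesz_form_cut_bound[of A B C "\<bar>R\<bar>" a b "(a+b-c)/2", unfolded m(3)])
         (auto simp: m)
    also have "\<dots> \<le> riesz_form (cint a) (cint b) (cint c)"
      using 4 nn by (intro riesz_form_cint_ge) auto
    finally show ?thesis .
  qed
qed

section \<open>Steiner symmetrization\<close>

text \<open>
  The section of \<open>A\<close> by the line through \<open>x\<close> in direction \<open>e\<close>, parametrized from \<open>x\<close>.
\<close>

definition slice :: "'a::euclidean_space \<Rightarrow> 'a set \<Rightarrow> 'a \<Rightarrow> real set" where
  "slice e A x = {t. x + t *\<^sub>R e \<in> A}"

text \<open>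
  The indicator of \<open>{x. 0 \<le> x \<bullet> e \<le> 1}\<close>. Each line in the direction of the unit vector \<open>e\<close> meets this
  slab in a segment of length one, so Lebesgue measure on the slab serves as a measure on the set of
  all these lines.
\<close>

definition slab :: "'a::euclidean_space \<Rightarrow> 'a \<Rightarrow> ennreal" where
  "slab e x = indicator {0..1} (x \<bullet> e)"

lemma measurable_slab [measurable]: "slab e \<in> borel_measurable borel"
  unfolding slab_def by measurable

lemma sets_slice [measurable]: "A \<in> sets borel \<Longrightarrow> slice e A x \<in> sets borel"
  using measurable_sets[of "\<lambda>t. x + t *\<^sub>R e" borel borel A] by (simp add: slice_def vimage_def)

text \<open>
  Integration over all lines in direction \<open>e\<close>. Weighting the lines by the slab replaces a rotation
  to a coordinate direction followed by a splitting into a product.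
\<close>

lemma nn_integral_slices:
  fixes e :: "'a::euclidean_space"
  assumes e: "norm e = 1" and [measurable]: "F \<in> borel_measurable borel"
  shows "(\<integral>\<^sup>+x. F x \<partial>lborel) = (\<integral>\<^sup>+x. slab e x * (\<integral>\<^sup>+t. F (x + t *\<^sub>R e) \<partial>lborel) \<partial>lborel)"
proof -
  have ee: "e \<bullet> e = 1" using e by (simp add: norm_eq_1)
  have "(\<integral>\<^sup>+x. slab e x * (\<integral>\<^sup>+t. F (x + t *\<^sub>R e) \<partial>lborel) \<partial>lborel) =
    (\<integral>\<^sup>+x. \<integral>\<^sup>+t. slab e x * F (x + t *\<^sub>R e) \<partial>lborel \<partial>lborel)"
    by (simp add: nn_integral_cmult)
  also have "\<dots> = (\<integral>\<^sup>+t. \<integral>\<^sup>+x. slab e x * F (x + t *\<^sub>R e) \<partial>lborel \<partial>lborel)"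
    by (rule lborel_pair.Fubini') measurable
  also have "\<dots> = (\<integral>\<^sup>+t. \<integral>\<^sup>+x. slab e (x - t *\<^sub>R e) * F x \<partial>lborel \<partial>lborel)"
  proof (rule nn_integral_cong)
    fix t :: real
    show "(\<integral>\<^sup>+x. slab e x * F (x + t *\<^sub>R e) \<partial>lborel) = (\<integral>\<^sup>+x. slab e (x - t *\<^sub>R e) * F x \<partial>lborel)"
      using nn_integral_lborel_plus[of "\<lambda>x. slab e (x - t *\<^sub>R e) * F x" "t *\<^sub>R e"]
      by (simp add: add.commute)
  qed
  also have "\<dots> = (\<integral>\<^sup>+x. \<integral>\<^sup>+t. slab e (x - t *\<^sub>R e) * F x \<partial>lborel \<partial>lborel)"
    by (rule lborel_pair.Fubini') measurable
  also have "\<dots> = (\<integral>\<^sup>+x. F x \<partial>lborel)"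
  proof (rule nn_integral_cong)
    fix x :: 'a
    have "(\<integral>\<^sup>+t. slab e (x - t *\<^sub>R e) * F x \<partial>lborel) = (\<integral>\<^sup>+t. indicator {0..1} (x \<bullet> e - t) \<partial>lborel) * F x"
      by (simp add: slab_def inner_diff_left ee nn_integral_multc)
    also have "\<dots> = F x"
      by (simp add: emeasure_minus_vimage)
    finally show "(\<integral>\<^sup>+t. slab e (x - t *\<^sub>R e) * F x \<partial>lborel) = F x" .
  qed
  finally show ?thesis ..
qed

lemma measurable_emeasure_slice [measurable]:
  assumes [measurable]: "A \<in> sets borel"
  shows "(\<lambda>x. emeasure lborel (slice e A x)) \<in> borel_measurable borel"
proof -
  have "emeasure lborel (slice e A x) = (\<integral>\<^sup>+t. indicator A (x + t *\<^sub>R e) \<partial>lborel)" for x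
  proof -
    have "indicator A (x + t *\<^sub>R e) = (indicator (slice e A x) t :: ennreal)" for t
      by (simp add: slice_def split: split_indicator)
    then show ?thesis by simp
  qed
  then show ?thesis by simp
qed

lemma emeasure_slices:
  assumes e: "norm e = 1" and [measurable]: "A \<in> sets borel"
  shows "emeasure lborel A = (\<integral>\<^sup>+x. slab e x * emeasure lborel (slice e A x) \<partial>lborel)"
proof -
  have "indicator A (x + t *\<^sub>R e) = (indicator (slice e A x) t :: ennreal)" for x t
    by (simp add: slice_def split: split_indicator)
  then show ?thesis
    using nn_integral_slices[OF e, of "indicator A"] by simp
qed

lemma nn_integral_lborel_hyperplane_reflection:
  fixes e :: "'a::euclidean_space"
  assumes e: "norm e = 1" and [measurable]: "F \<in> borel_measurable borel"
  shows "(\<integral>\<^sup>+x. F (x - (2 * (x \<bullet> e)) *\<^sub>R e) \<partial>lborel) = (\<integral>\<^sup>+x. F x \<partial>lborel)"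
proof -
  have ee: "e \<bullet> e = 1" using e by (simp add: norm_eq_1)
  have "(\<integral>\<^sup>+x. F (x - (2 * (x \<bullet> e)) *\<^sub>R e) \<partial>lborel) =
    (\<integral>\<^sup>+x. slab e x * (\<integral>\<^sup>+t. F (x + t *\<^sub>R e - (2 * ((x + t *\<^sub>R e) \<bullet> e)) *\<^sub>R e) \<partial>lborel) \<partial>lborel)"
    by (rule nn_integral_slices[OF e]) measurable
  also have "\<dots> = (\<integral>\<^sup>+x. slab e x * (\<integral>\<^sup>+t. F (x + t *\<^sub>R e) \<partial>lborel) \<partial>lborel)"
  proof (rule nn_integral_cong)
    fix x
    have *: "x + t *\<^sub>R e - (2 * ((x + t *\<^sub>R e) \<bullet> e)) *\<^sub>R e = x + (- 2 * (x \<bullet> e) - t) *\<^sub>R e" for t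
      by (simp add: inner_add_left ee algebra_simps flip: scaleR_add_left mult_2)
    show "slab e x * (\<integral>\<^sup>+t. F (x + t *\<^sub>R e - (2 * ((x + t *\<^sub>R e) \<bullet> e)) *\<^sub>R e) \<partial>lborel) =
      slab e x * (\<integral>\<^sup>+t. F (x + t *\<^sub>R e) \<partial>lborel)"
      using nn_integral_lborel_minus[of "\<lambda>t. F (x + t *\<^sub>R e)" "- 2 * (x \<bullet> e)"]
      unfolding * by simp
  qed
  also have "\<dots> = (\<integral>\<^sup>+x. F x \<partial>lborel)"
    by (rule nn_integral_slices[OF e, symmetric]) measurable
  finally show ?thesis .
qed

lemma riesz_form_slices:
  assumes e: "norm e = 1" and [measurable]: "A \<in> sets borel" "B \<in> sets borel" "C \<in> sets borel"
  shows "riesz_form A B C = (\<integral>\<^sup>+x. slab e x * (\<integral>\<^sup>+y. slab e y *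
      riesz_form (slice e A x) (slice e B y) (slice e C (x + y)) \<partial>lborel) \<partial>lborel)"
proof -
  define g where "g x y = (indicator A x * indicator B y * indicator C (x + y) :: ennreal)" for x y
  have [measurable]: "(\<lambda>p. g (fst p) (snd p)) \<in> borel_measurable (borel \<Otimes>\<^sub>M borel)"
    unfolding g_def by measurable
  have g [measurable (raw)]: "(\<lambda>p. g (f p) (h p)) \<in> borel_measurable M"
    if "f \<in> borel_measurable M" "h \<in> borel_measurable M" for f h and M :: "'x measure"
    using that unfolding g_def by measurable
  have "riesz_form A B C = (\<integral>\<^sup>+x. \<integral>\<^sup>+y. g x y \<partial>lborel \<partial>lborel)"
    by (simp add: riesz_form_def g_def)
  also have "\<dots> = (\<integral>\<^sup>+x. slab e x * (\<integral>\<^sup>+s. \<integral>\<^sup>+y. g (x + s *\<^sub>R e) y \<partial>lborel \<partial>lborel) \<partial>lborel)"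
    by (rule nn_integral_slices[OF e]) measurable
  also have "\<dots> = (\<integral>\<^sup>+x. slab e x * (\<integral>\<^sup>+s. \<integral>\<^sup>+y. slab e y * (\<integral>\<^sup>+t. g (x + s *\<^sub>R e) (y + t *\<^sub>R e) \<partial>lborel) \<partial>lborel \<partial>lborel) \<partial>lborel)"
    by (subst nn_integral_slices[OF e]) simp_all
  also have "\<dots> = (\<integral>\<^sup>+x. slab e x * (\<integral>\<^sup>+y. \<integral>\<^sup>+s. slab e y * (\<integral>\<^sup>+t. g (x + s *\<^sub>R e) (y + t *\<^sub>R e) \<partial>lborel) \<partial>lborel \<partial>lborel) \<partial>lborel)"
    by (subst lborel_pair.Fubini') simp_all
  also have "\<dots> = (\<integral>\<^sup>+x. slab e x * (\<integral>\<^sup>+y. slab e y *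
      riesz_form (slice e A x) (slice e B y) (slice e C (x + y)) \<partial>lborel) \<partial>lborel)"
  proof (intro nn_integral_cong arg_cong[where f="(*) _"])
    fix x y
    have "g (x + s *\<^sub>R e) (y + t *\<^sub>R e) = indicator (slice e A x) s * indicator (slice e B y) t *
       indicator (slice e C (x + y)) (s + t)" for s t
      by (simp add: g_def slice_def algebra_simps split: split_indicator)
    then show "(\<integral>\<^sup>+s. slab e y * (\<integral>\<^sup>+t. g (x + s *\<^sub>R e) (y + t *\<^sub>R e) \<partial>lborel) \<partial>lborel) =
       slab e y * riesz_form (slice e A x) (slice e B y) (slice e C (x + y))"
      by (simp add: riesz_form_def nn_integral_cmult)
  qed
  finally show ?thesis .
qed

lemma riesz_form_translate:
  assumes [measurable]: "A \<in> sets borel" "B \<in> sets borel" "C \<in> sets borel"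
  shows "riesz_form {s. p + s \<in> A} {t. q + t \<in> B} {u. p + q + u \<in> C} = riesz_form A B C"
proof -
  have "riesz_form {s. p + s \<in> A} {t. q + t \<in> B} {u. p + q + u \<in> C} =
    (\<integral>\<^sup>+x. \<integral>\<^sup>+y. indicator A (p + x) * indicator B (q + y) * indicator C ((p + x) + (q + y)) \<partial>lborel \<partial>lborel)"
    unfolding riesz_form_def by (intro nn_integral_cong) (auto simp: ac_simps split: split_indicator)
  also have "\<dots> = (\<integral>\<^sup>+x. \<integral>\<^sup>+y. indicator A (p + x) * indicator B y * indicator C ((p + x) + y) \<partial>lborel \<partial>lborel)"
  proof (rule nn_integral_cong)
    fix x
    show "(\<integral>\<^sup>+y. indicator A (p + x) * indicator B (q + y) * indicator C ((p + x) + (q + y)) \<partial>lborel) =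
      (\<integral>\<^sup>+y. indicator A (p + x) * indicator B y * indicator C ((p + x) + y) \<partial>lborel :: ennreal)"
      by (rule nn_integral_lborel_plus[of "\<lambda>y. indicator A (p + x) * indicator B y * indicator C ((p + x) + y)"]) measurable
  qed
  also have "\<dots> = riesz_form A B C"
    unfolding riesz_form_def
    by (rule nn_integral_lborel_plus[of "\<lambda>x. \<integral>\<^sup>+y. indicator A x * indicator B y * indicator C (x + y) \<partial>lborel"]) measurable
  finally show ?thesis .
qed

text \<open>
  Steiner symmetrization in direction \<open>e\<close> (a unit vector): each section of \<open>A\<close> by a line in direction
  \<open>e\<close> is replaced by the open interval of the same length centred on the hyperplane orthogonal to
  \<open>e\<close>. A section of infinite measure becomes the whole line.
\<close>

definition steiner :: "'a::euclidean_space \<Rightarrow> 'a set \<Rightarrow> 'a set" where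
  "steiner e A = {x. ennreal (2 * \<bar>x \<bullet> e\<bar>) < emeasure lborel (slice e A x)}"

lemma sets_steiner [measurable]:
  assumes [measurable]: "A \<in> sets borel"
  shows "steiner e A \<in> sets borel"
  unfolding steiner_def by measurable

lemma slice_shift: "slice e A (x + s *\<^sub>R e) = {t. s + t \<in> slice e A x}"
  by (auto simp: slice_def algebra_simps)

lemma emeasure_shift:
  assumes [measurable]: "(A :: 'a::euclidean_space set) \<in> sets borel"
  shows "emeasure lborel {t. s + t \<in> A} = emeasure lborel A"
proof -
  have "indicator A (s + t) = (indicator {t. s + t \<in> A} t :: ennreal)" for t
    by (simp split: split_indicator)
  then show ?thesis
    using nn_integral_lborel_plus[of "indicator A" s] by simp
qed

lemma slice_steiner:
  assumes e: "norm e = 1" and [measurable]: "A \<in> sets borel"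
    and l: "emeasure lborel (slice e A x) = ennreal l"
  shows "slice e (steiner e A) x = {s. x \<bullet> e + s \<in> cint l}"
proof -
  have ee: "e \<bullet> e = 1" using e by (simp add: norm_eq_1)
  have "emeasure lborel (slice e A (x + s *\<^sub>R e)) = ennreal l" for s
    unfolding slice_shift using l by (simp add: emeasure_shift)
  then have "x + s *\<^sub>R e \<in> steiner e A \<longleftrightarrow> 2 * \<bar>x \<bullet> e + s\<bar> < l" for s
    by (simp add: steiner_def inner_add_left ee ennreal_less_iff)
  moreover have "2 * \<bar>u\<bar> < l \<longleftrightarrow> u \<in> cint l" for u
    by auto
  ultimately show ?thesis
    unfolding slice_def by simp
qed

lemma emeasure_cint [simp]: "0 \<le> l \<Longrightarrow> emeasure lborel (cint l) = ennreal l"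
  by simp

lemma emeasure_slice_steiner:
  assumes e: "norm e = 1" and [measurable]: "A \<in> sets borel"
    and fin: "emeasure lborel (slice e A x) < \<infinity>"
  shows "emeasure lborel (slice e (steiner e A) x) = emeasure lborel (slice e A x)"
proof -
  obtain l where l: "emeasure lborel (slice e A x) = ennreal l" "0 \<le> l"
    using fin by (cases "emeasure lborel (slice e A x)") auto
  show ?thesis
    unfolding slice_steiner[OF e assms(2) l(1)] using l
    by (simp only: emeasure_shift greaterThanLessThan_borel emeasure_cint)
qed

lemma slice_subset_interval:
  assumes e: "norm e = 1" and bd: "A \<subseteq> ball 0 R"
  shows "slice e A x \<subseteq> {-(R + norm x)..R + norm x}"
proof
  fix t assume "t \<in> slice e A x"
  then have "norm (x + t *\<^sub>R e) < R" using bd by (auto simp: slice_def)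
  moreover have "norm (t *\<^sub>R e) \<le> norm (x + t *\<^sub>R e) + norm x"
    by (metis add.commute add_diff_cancel_left' norm_triangle_ineq4)
  ultimately have "\<bar>t\<bar> \<le> R + norm x" using e by simp
  then show "t \<in> {-(R + norm x)..R + norm x}" by auto
qed

lemma emeasure_slice_finite:
  assumes e: "norm e = 1" and bd: "A \<subseteq> ball 0 R"
  shows "emeasure lborel (slice e A x) < \<infinity>"
proof -
  have "emeasure lborel (slice e A x) \<le> emeasure lborel {-(R + norm x)..R + norm x}"
    by (intro emeasure_mono slice_subset_interval[OF e bd]) simp
  also have "\<dots> < \<infinity>"
    by (cases "0 \<le> R + norm x") auto
  finally show ?thesis .
qed

lemma emeasure_steiner:
  assumes e: "norm e = 1" and [measurable]: "A \<in> sets borel" and bd: "A \<subseteq> ball 0 R"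
  shows "emeasure lborel (steiner e A) = emeasure lborel A"
  using emeasure_slice_steiner[OF e _ emeasure_slice_finite[OF e bd]]
  by (simp add: emeasure_slices[OF e])

lemma steiner_mono:
  assumes [measurable]: "A \<in> sets borel" "B \<in> sets borel" and "A \<subseteq> B"
  shows "steiner e A \<subseteq> steiner e B"
proof -
  have "slice e A x \<subseteq> slice e B x" for x using \<open>A \<subseteq> B\<close> by (auto simp: slice_def)
  then have "emeasure lborel (slice e A x) \<le> emeasure lborel (slice e B x)" for x
    by (intro emeasure_mono) simp_all
  then show ?thesis
    by (auto simp: steiner_def intro: less_le_trans)
qed

lemma steiner_ball:
  assumes e: "norm e = 1"
  shows "steiner e (ball 0 r) = ball 0 r"
proof (rule set_eqI)
  fix x
  have ee: "e \<bullet> e = 1" using e by (simp add: norm_eq_1)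
  define q where "q = r\<^sup>2 - (norm x)\<^sup>2 + (x \<bullet> e)\<^sup>2"
  show "x \<in> steiner e (ball 0 r) \<longleftrightarrow> x \<in> ball 0 r"
  proof (cases "r > 0")
    case False
    then have "ball (0::'a) r = {}" by simp
    then show ?thesis unfolding steiner_def slice_def by (simp only:) simp
  next
    case True
    have n: "(norm (x + t *\<^sub>R e))\<^sup>2 = (t + x \<bullet> e)\<^sup>2 + ((norm x)\<^sup>2 - (x \<bullet> e)\<^sup>2)" for t
      unfolding power2_norm_eq_inner
      by (simp add: inner_add_left inner_add_right ee power2_eq_square inner_commute algebra_simps)
    have mem: "norm (x + t *\<^sub>R e) < r \<longleftrightarrow> (t + x \<bullet> e)\<^sup>2 < q" for t
    proof -
      have "norm (x + t *\<^sub>R e) < r \<longleftrightarrow> (norm (x + t *\<^sub>R e))\<^sup>2 < r\<^sup>2"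
        using True by (metis norm_ge_zero less_eq_real_def pos2 power_strict_mono power_less_imp_less_base)
      then show ?thesis unfolding n q_def by linarith
    qed
    have sq: "u\<^sup>2 < q \<longleftrightarrow> \<bar>u\<bar> < sqrt q" for u
      by (metis real_sqrt_abs real_sqrt_less_iff)
    have "slice e (ball 0 r) x = {t. x \<bullet> e + t \<in> {-sqrt q<..<sqrt q}}"
      by (auto simp: slice_def mem sq abs_less_iff)
    then have "emeasure lborel (slice e (ball 0 r) x) = emeasure lborel {-sqrt q<..<sqrt q}"
      by (simp only: emeasure_shift greaterThanLessThan_borel)
    then have L: "emeasure lborel (slice e (ball 0 r) x) = ennreal (2 * sqrt q)"
      by (cases "0 \<le> sqrt q") (auto simp: ennreal_neg)
    have "x \<in> steiner e (ball 0 r) \<longleftrightarrow> \<bar>x \<bullet> e\<bar> < sqrt q"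
      unfolding steiner_def mem_Collect_eq L by (simp add: ennreal_less_iff)
    also have "\<dots> \<longleftrightarrow> norm (x + 0 *\<^sub>R e) < r"
      unfolding mem sq by simp
    finally show ?thesis by simp
  qed
qed

lemma steiner_subset_ball:
  assumes "norm e = 1" "A \<in> sets borel" "A \<subseteq> ball 0 R"
  shows "steiner e A \<subseteq> ball 0 R"
  using steiner_mono[of A "ball 0 R" e] steiner_ball[of e R] assms by simp

theorem riesz_form_le_steiner:
  assumes e: "norm e = 1" and [measurable]: "A \<in> sets borel" "B \<in> sets borel" "C \<in> sets borel"
    and bd: "A \<subseteq> ball 0 R" "B \<subseteq> ball 0 R" "C \<subseteq> ball 0 R"
  shows "riesz_form A B C \<le> riesz_form (steiner e A) (steiner e B) (steiner e C)"
proof -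
  have "riesz_form (slice e A x) (slice e B y) (slice e C (x + y)) \<le>
      riesz_form (slice e (steiner e A) x) (slice e (steiner e B) y) (slice e (steiner e C) (x + y))" for x y
  proof -
    obtain a where a: "emeasure lborel (slice e A x) = ennreal a" "0 \<le> a"
      using emeasure_slice_finite[OF e bd(1), of x] by (cases "emeasure lborel (slice e A x)") auto
    obtain b where b: "emeasure lborel (slice e B y) = ennreal b" "0 \<le> b"
      using emeasure_slice_finite[OF e bd(2), of y] by (cases "emeasure lborel (slice e B y)") auto
    obtain c where c: "emeasure lborel (slice e C (x + y)) = ennreal c" "0 \<le> c"
      using emeasure_slice_finite[OF e bd(3), of "x + y"] by (cases "emeasure lborel (slice e C (x + y))") auto
    have "riesz_form (slice e A x) (slice e B y) (slice e C (x + y)) \<le> riesz_form (cint a) (cint b) (cint c)"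
    proof (rule riesz_real)
      show "slice e A x \<subseteq> {- max (R + norm x) (R + norm y)..max (R + norm x) (R + norm y)}"
        using slice_subset_interval[OF e bd(1), of x] by (auto simp: subset_eq)
      show "slice e B y \<subseteq> {- max (R + norm x) (R + norm y)..max (R + norm x) (R + norm y)}"
        using slice_subset_interval[OF e bd(2), of y] by (auto simp: subset_eq)
    qed (use a b c in auto)
    also have "\<dots> = riesz_form {s. x \<bullet> e + s \<in> cint a} {s. y \<bullet> e + s \<in> cint b} {s. x \<bullet> e + y \<bullet> e + s \<in> cint c}"
      by (rule riesz_form_translate[symmetric]) simp_all
    finally show ?thesis
      by (simp only: slice_steiner[OF e assms(2) a(1)] slice_steiner[OF e assms(3) b(1)]
          slice_steiner[OF e assms(4) c(1)] inner_add_left)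
  qed
  then show ?thesis
    unfolding riesz_form_slices[OF e assms(2-4)]
    by (subst riesz_form_slices[OF e]) (auto intro!: nn_integral_mono mult_left_mono)
qed

text \<open>
  Symmetrized sections are nested, so their overlap is as large as possible. On each line it
  exceeds the original overlap at least by the measure of the points of \<open>A - B\<close> that a common
  translation along the line carries to \<open>B - A\<close>.
\<close>

lemma steiner_overlap:
  assumes e: "norm e = 1" and [measurable]: "A \<in> sets borel" "B \<in> sets borel"
    and bd: "A \<subseteq> ball 0 R" "B \<subseteq> ball 0 R"
  shows "emeasure lborel (A \<inter> B) + emeasure lborel {x \<in> A - B. x + \<tau> *\<^sub>R e \<in> B - A}
    \<le> emeasure lborel (steiner e A \<inter> steiner e B)"
proof -
  define D where "D = {x \<in> A - B. x + \<tau> *\<^sub>R e \<in> B - A}"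
  have [measurable]: "D \<in> sets borel" unfolding D_def by measurable
  have "emeasure lborel (A \<inter> B) + emeasure lborel D = emeasure lborel ((A \<inter> B) \<union> D)"
    by (rule plus_emeasure) (auto simp: D_def)
  also have "\<dots> \<le> emeasure lborel (steiner e A \<inter> steiner e B)"
  proof -
    have "emeasure lborel (slice e ((A \<inter> B) \<union> D) x) \<le> emeasure lborel (slice e (steiner e A \<inter> steiner e B) x)" for x
    proof -
      obtain a where a: "emeasure lborel (slice e A x) = ennreal a" "0 \<le> a"
        using emeasure_slice_finite[OF e bd(1), of x] by (cases "emeasure lborel (slice e A x)") auto
      obtain b where b: "emeasure lborel (slice e B x) = ennreal b" "0 \<le> b"
        using emeasure_slice_finite[OF e bd(2), of x] by (cases "emeasure lborel (slice e B x)") auto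
      have shift: "t \<in> slice e (B - A) x" if "- \<tau> + t \<in> slice e D x" for t
      proof -
        have eq: "x + (- \<tau> + t) *\<^sub>R e + \<tau> *\<^sub>R e = x + t *\<^sub>R e" by (simp add: algebra_simps)
        have "x + (- \<tau> + t) *\<^sub>R e + \<tau> *\<^sub>R e \<in> B - A"
          using that by (simp add: slice_def D_def)
        then show ?thesis unfolding eq by (simp add: slice_def)
      qed
      have D: "slice e D x \<subseteq> slice e A x" "slice e D x \<inter> slice e B x = {}"
        by (auto simp: slice_def D_def)
      have U: "slice e ((A \<inter> B) \<union> D) x = (slice e A x \<inter> slice e B x) \<union> slice e D x"
        by (auto simp: slice_def)
      have BA: "slice e (B - A) x = slice e B x - slice e A x"
        by (auto simp: slice_def)
      define D' where "D' = {t. - \<tau> + t \<in> slice e D x}"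
      have D': "D' \<subseteq> slice e B x" "D' \<inter> slice e A x = {}"
        using shift unfolding BA D'_def by auto
      have [measurable]: "D' \<in> sets borel"
        unfolding D'_def using sets_slice[of D e "x + (- \<tau>) *\<^sub>R e"] by (simp only: slice_shift) simp
      have 1: "emeasure lborel (slice e ((A \<inter> B) \<union> D) x) \<le> ennreal a"
        unfolding a(1)[symmetric] U by (intro emeasure_mono) (use D in auto)
      have "emeasure lborel (slice e ((A \<inter> B) \<union> D) x) =
          emeasure lborel (slice e A x \<inter> slice e B x) + emeasure lborel (slice e D x)"
        unfolding U by (rule plus_emeasure[symmetric]) (use D in auto)
      also have "emeasure lborel (slice e D x) = emeasure lborel D'"
        unfolding D'_def by (rule emeasure_shift[symmetric]) simp
      also have "emeasure lborel (slice e A x \<inter> slice e B x) + \<dots> =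
         emeasure lborel ((slice e A x \<inter> slice e B x) \<union> D')"
        by (rule plus_emeasure) (use D' in auto)
      also have "\<dots> \<le> ennreal b"
        unfolding b(1)[symmetric] by (intro emeasure_mono) (use D' in auto)
      finally have 2: "emeasure lborel (slice e ((A \<inter> B) \<union> D) x) \<le> ennreal b" .
      have "slice e (steiner e A \<inter> steiner e B) x = slice e (steiner e A) x \<inter> slice e (steiner e B) x"
        by (auto simp: slice_def)
      also have "\<dots> = {s. x \<bullet> e + s \<in> cint (min a b)}"
        unfolding slice_steiner[OF e assms(2) a(1)] slice_steiner[OF e assms(3) b(1)]
        by auto
      finally have "emeasure lborel (slice e (steiner e A \<inter> steiner e B) x) = emeasure lborel (cint (min a b))"
        by (simp only: emeasure_shift greaterThanLessThan_borel)
      then show ?thesis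
        using 1 2 a b by (auto simp: min_def)
    qed
    then show ?thesis
      by (simp add: emeasure_slices[OF e]) (auto intro!: nn_integral_mono mult_left_mono)
  qed
  finally show ?thesis unfolding D_def .
qed

section \<open>Convergence to balls and the Riesz inequality in every dimension\<close>

text \<open>
  The symmetric rearrangement of a set of finite volume: the open ball about the origin with the same
  volume. On sets of infinite volume \<open>measure\<close> is zero by convention, so these are sent to the empty
  ball.
\<close>

definition rearr :: "'a::euclidean_space set \<Rightarrow> 'a set" where
  "rearr A = ball 0 (root DIM('a) (measure lborel A / unit_ball_vol (real DIM('a))))"

lemma sets_rearr [measurable]: "rearr A \<in> sets borel"
  by (simp add: rearr_def)

lemma emeasure_rearr:
  fixes A :: "'a::euclidean_space set"
  assumes "emeasure lborel A < \<infinity>"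
  shows "emeasure lborel (rearr A) = emeasure lborel A"
proof -
  have "emeasure lborel (rearr A) = ennreal (measure lborel A)"
    unfolding rearr_def by (subst emeasure_ball) (auto simp: real_root_pow_pos2 less_imp_neq[OF unit_ball_vol_pos, symmetric])
  then show ?thesis
    using assms by (subst emeasure_eq_ennreal_measure) auto
qed

lemma rearr_mono:
  assumes "measure lborel A \<le> measure lborel B"
  shows "rearr A \<subseteq> rearr B"
  unfolding rearr_def
  by (intro subset_ball real_root_le_mono divide_right_mono assms) auto

lemma rearr_cong:
  "emeasure lborel A = emeasure lborel B \<Longrightarrow> rearr A = rearr B"
  by (simp add: rearr_def measure_def)

lemma emeasure_ball_finite: "emeasure lborel (ball c R) < \<infinity>"
  by (meson emeasure_bounded_finite bounded_ball)

lemma rearr_ball: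
  assumes "0 \<le> R" shows "rearr (ball (0::'a::euclidean_space) R) = ball 0 R"
proof -
  have "measure lborel (ball (0::'a) R) = unit_ball_vol (real DIM('a)) * R ^ DIM('a)"
    using assms by (simp add: content_ball)
  then show ?thesis
    using assms unit_ball_vol_pos[of "real DIM('a)"] by (simp add: rearr_def real_root_power_cancel less_imp_neq[OF unit_ball_vol_pos, symmetric])
qed

lemma rearr_subset_ball:
  assumes [measurable]: "A \<in> sets borel" and "A \<subseteq> ball (0::'a::euclidean_space) R" "0 \<le> R"
  shows "rearr A \<subseteq> ball 0 R"
proof -
  have "measure lborel A \<le> measure lborel (ball (0::'a) R)"
    using assms emeasure_ball_finite[of "0::'a" R] by (intro measure_mono_fmeasurable) (auto simp: fmeasurable_def)
  then show ?thesis
    using rearr_mono[of A "ball 0 R"] rearr_ball[OF \<open>0 \<le> R\<close>] by auto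
qed

text \<open>
  The measure of \<open>{x \<in> E. x + v \<in> F}\<close> integrates over \<open>v\<close> to \<open>m\<^sup>2\<close> and vanishes unless \<open>v\<close> lies in the
  ball of radius \<open>2 * R\<close>.
\<close>

lemma exists_good_translation:
  fixes E F :: "'a::euclidean_space set"
  assumes [measurable]: "E \<in> sets borel" "F \<in> sets borel"
    and bd: "E \<subseteq> ball 0 R" "F \<subseteq> ball 0 R"
    and m: "emeasure lborel E = ennreal m" "emeasure lborel F = ennreal m" "0 < m" and R: "0 < R"
  defines "V \<equiv> measure lborel (ball (0::'a) (2 * R))"
  shows "\<exists>v. ennreal (m\<^sup>2 / (2 * V)) \<le> emeasure lborel {x \<in> E. x + v \<in> F}"
proof (rule ccontr)
  assume neg: "\<not> ?thesis"
  have eV: "emeasure lborel (ball (0::'a) (2 * R)) = ennreal V"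
    unfolding V_def using emeasure_ball_finite[of "0::'a" "2 * R"] by (intro emeasure_eq_ennreal_measure) auto
  have V: "0 < V"
    unfolding V_def using R by (simp add: content_ball unit_ball_vol_pos)
  have "emeasure lborel E * emeasure lborel F =
      (\<integral>\<^sup>+x. \<integral>\<^sup>+y. indicator E x * indicator F y \<partial>lborel \<partial>lborel)"
    by (simp add: nn_integral_cmult nn_integral_multc)
  also have "\<dots> = (\<integral>\<^sup>+x. \<integral>\<^sup>+v. indicator E x * indicator F (x + v) \<partial>lborel \<partial>lborel)"
    by (subst nn_integral_lborel_plus[of "\<lambda>y. indicator E _ * indicator F y"]) simp_all
  also have "\<dots> = (\<integral>\<^sup>+v. \<integral>\<^sup>+x. indicator E x * indicator F (x + v) \<partial>lborel \<partial>lborel)"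
    by (rule lborel_pair.Fubini') measurable
  also have "\<dots> = (\<integral>\<^sup>+v. emeasure lborel {x \<in> E. x + v \<in> F} \<partial>lborel)"
  proof (rule nn_integral_cong)
    fix v
    have "indicator E x * indicator F (x + v) = (indicator {x \<in> E. x + v \<in> F} x :: ennreal)" for x
      by (simp split: split_indicator)
    then show "(\<integral>\<^sup>+x. indicator E x * indicator F (x + v) \<partial>lborel) = emeasure lborel {x \<in> E. x + v \<in> F}"
      by simp
  qed
  also have "\<dots> \<le> (\<integral>\<^sup>+v. ennreal (m\<^sup>2 / (2 * V)) * indicator (ball (0::'a) (2 * R)) v \<partial>lborel)"
  proof (rule nn_integral_mono)
    fix v :: 'a
    show "emeasure lborel {x \<in> E. x + v \<in> F} \<le> ennreal (m\<^sup>2 / (2 * V)) * indicator (ball 0 (2 * R)) v"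
    proof (cases "{x \<in> E. x + v \<in> F} = {}")
      case False
      then obtain x where "x \<in> E" "x + v \<in> F" by auto
      then have "norm x < R" "norm (x + v) < R" using bd by auto
      moreover have "norm v \<le> norm (x + v) + norm x"
        by (metis add.commute add_diff_cancel_left' norm_triangle_ineq4)
      ultimately have "v \<in> ball 0 (2 * R)" by simp
      then show ?thesis using neg by (simp add: not_le less_imp_le)
    next
      case True
      show ?thesis unfolding True by simp
    qed
  qed
  also have "\<dots> = ennreal (m\<^sup>2 / (2 * V)) * ennreal V"
    by (subst nn_integral_cmult_indicator) (simp_all only: eV, simp)
  finally have "m * m \<le> m\<^sup>2 / (2 * V) * V"
    using m V by (simp add: ennreal_mult[symmetric])
  also have "\<dots> = m * m / 2"
    using V by (simp add: power2_eq_square)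
  finally show False
    using m by (simp add: mult_le_0_iff)
qed

lemma finite_emeasure_subset_ball:
  assumes "A \<subseteq> ball (0::'a::euclidean_space) R" shows "emeasure lborel A < \<infinity>"
  using assms emeasure_bounded_finite bounded_subset bounded_ball by metis

lemma measure_diff_equal:
  assumes [measurable]: "A \<in> sets borel" and fin: "emeasure lborel A < \<infinity>"
    and B[measurable]: "B \<in> sets borel" "emeasure lborel B = emeasure lborel A"
  shows "measure lborel (A - B) = measure lborel A - measure lborel (A \<inter> B)"
    "measure lborel (B - A) = measure lborel (A - B)"
proof -
  have diff: "measure lborel (E - F) = measure lborel E - measure lborel (E \<inter> F)"
    if "E \<in> sets borel" "F \<in> sets borel" "emeasure lborel E < \<infinity>" for E F :: "'a set"
  proof -
    have "measure lborel (E - E \<inter> F) = measure lborel E - measure lborel (E \<inter> F)"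
      using that by (intro measure_Diff) auto
    then show ?thesis by (simp add: Diff_Int)
  qed
  show 1: "measure lborel (A - B) = measure lborel A - measure lborel (A \<inter> B)"
    using fin by (intro diff) simp_all
  have "measure lborel (B - A) = measure lborel B - measure lborel (B \<inter> A)"
    using fin B by (intro diff) simp_all
  then show "measure lborel (B - A) = measure lborel (A - B)"
    using 1 B by (simp add: measure_def Int_commute)
qed

lemma steiner_defect:
  assumes e: "norm e = 1" and [measurable]: "A \<in> sets borel" and bd: "A \<subseteq> ball 0 R" and R: "0 < R"
  shows "measure lborel (steiner e A - rearr A) \<le> measure lborel (A - rearr A) -
     measure lborel {x \<in> A - rearr A. x + \<tau> *\<^sub>R e \<in> rearr A - A}"
proof -
  let ?B = "rearr A"
  let ?D = "{x \<in> A - ?B. x + \<tau> *\<^sub>R e \<in> ?B - A}"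
  have fin: "emeasure lborel A < \<infinity>" by (rule finite_emeasure_subset_ball[OF bd])
  have bB: "?B \<subseteq> ball 0 R" using rearr_subset_ball[OF _ bd] R by simp
  have sB: "steiner e ?B = ?B" unfolding rearr_def by (rule steiner_ball[OF e])
  have sA: "emeasure lborel (steiner e A) = emeasure lborel A" by (rule emeasure_steiner[OF e _ bd]) simp
  have mD: "?D \<in> sets borel" by measurable
  have fm: "A \<inter> ?B \<in> fmeasurable lborel" "?D \<in> fmeasurable lborel" "steiner e A \<inter> ?B \<in> fmeasurable lborel"
    using fin bB mD finite_emeasure_subset_ball[of "A \<inter> ?B" R] finite_emeasure_subset_ball[of "steiner e A \<inter> ?B" R]
      finite_emeasure_subset_ball[of ?D R] bd
    by (auto simp: fmeasurable_def)
  have "emeasure lborel (A \<inter> ?B) + emeasure lborel ?D \<le> emeasure lborel (steiner e A \<inter> ?B)"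
    using steiner_overlap[OF e _ _ bd bB, of \<tau>] sB by simp
  then have "measure lborel (A \<inter> ?B) + measure lborel ?D \<le> measure lborel (steiner e A \<inter> ?B)"
    using fm by (simp add: emeasure_eq_measure2 ennreal_plus[symmetric] del: ennreal_plus)
  moreover have "measure lborel (steiner e A - ?B) = measure lborel (steiner e A) - measure lborel (steiner e A \<inter> ?B)"
    by (rule measure_diff_equal) (use fin sA emeasure_rearr[OF fin] in auto)
  moreover have "measure lborel (A - ?B) = measure lborel A - measure lborel (A \<inter> ?B)"
    by (rule measure_diff_equal) (use fin emeasure_rearr[OF fin] in auto)
  moreover have "measure lborel (steiner e A) = measure lborel A"
    using sA by (simp add: measure_def)
  ultimately show ?thesis by linarith
qed

text \<open>
  The direction is that of a translation provided by \<open>exists_good_translation\<close> for \<open>A - rearr A\<close>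
  and \<open>rearr A - A\<close>. The gain depends on \<open>A\<close> only through \<open>m\<close> and the radius \<open>R\<close>, which
  symmetrization does not change.
\<close>

lemma steiner_gain:
  fixes A :: "'a::euclidean_space set"
  assumes [measurable]: "A \<in> sets borel" and bd: "A \<subseteq> ball 0 R" and R: "0 < R"
    and m: "0 < m" "m \<le> measure lborel (A - rearr A)"
  shows "\<exists>e. norm e = 1 \<and> measure lborel (steiner e A - rearr A) \<le> measure lborel (A - rearr A) -
     m\<^sup>2 / (2 * measure lborel (ball (0::'a) (2 * R)))"
proof -
  let ?B = "rearr A"
  define m' where "m' = measure lborel (A - ?B)"
  define V where "V = measure lborel (ball (0::'a) (2 * R))"
  have V: "0 < V"
    unfolding V_def using R by (simp add: content_ball unit_ball_vol_pos)
  have fin: "emeasure lborel A < \<infinity>" by (rule finite_emeasure_subset_ball[OF bd])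
  have bB: "?B \<subseteq> ball 0 R" using rearr_subset_ball[OF _ bd] R by simp
  have eq: "measure lborel (?B - A) = m'"
    unfolding m'_def by (rule measure_diff_equal) (use fin emeasure_rearr[OF fin] in auto)
  have "emeasure lborel (A - ?B) = ennreal m'" "emeasure lborel (?B - A) = ennreal m'"
  proof -
    have "A - ?B \<subseteq> ball 0 R" "?B - A \<subseteq> ball 0 R" using bd bB by auto
    then show "emeasure lborel (A - ?B) = ennreal m'" "emeasure lborel (?B - A) = ennreal m'"
      using finite_emeasure_subset_ball[of "A - ?B" R] finite_emeasure_subset_ball[of "?B - A" R]
        emeasure_eq_ennreal_measure[of lborel "A - ?B"] emeasure_eq_ennreal_measure[of lborel "?B - A"] eq
      by (auto simp: m'_def)
  qed
  then obtain v where v: "ennreal (m'\<^sup>2 / (2 * V)) \<le> emeasure lborel {x \<in> A - ?B. x + v \<in> ?B - A}"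
    using exists_good_translation[of "A - ?B" "?B - A" R m'] bd bB R m
    unfolding V_def m'_def[symmetric] by auto
  have "0 < m'\<^sup>2 / (2 * V)" using m V by (simp add: m'_def)
  then have "{x \<in> A - ?B. x + v \<in> ?B - A} \<noteq> {}"
    using v by (metis emeasure_empty ennreal_eq_0_iff le_zero_eq not_le)
  then have "v \<noteq> 0" by auto
  define e where "e = v /\<^sub>R norm v"
  have e: "norm e = 1" "v = norm v *\<^sub>R e" using \<open>v \<noteq> 0\<close> by (auto simp: e_def)
  let ?D = "{x \<in> A - ?B. x + norm v *\<^sub>R e \<in> ?B - A}"
  have "emeasure lborel ?D = ennreal (measure lborel ?D)"
  proof -
    have "?D \<subseteq> ball 0 R" using bd by auto
    from finite_emeasure_subset_ball[OF this] show ?thesis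
      by (intro emeasure_eq_ennreal_measure) auto
  qed
  then have "m'\<^sup>2 / (2 * V) \<le> measure lborel ?D"
    using v e by (simp add: measure_nonneg)
  moreover have "m\<^sup>2 / (2 * V) \<le> m'\<^sup>2 / (2 * V)"
    using m V by (intro divide_right_mono power_mono) (auto simp: m'_def)
  ultimately show ?thesis
    using steiner_defect[OF e(1) _ bd R, of "norm v"] e(1) unfolding V_def by (intro exI[of _ e]) simp
qed

text \<open>
  Successive Steiner symmetrizations; the direction at the end of the list acts first.
\<close>

definition steiners :: "'a::euclidean_space list \<Rightarrow> 'a set \<Rightarrow> 'a set" where
  "steiners es A = foldr steiner es A"

lemma steiners_simps [simp]:
  "steiners [] A = A" "steiners (e # es) A = steiner e (steiners es A)"
  by (simp_all add: steiners_def)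

lemma steiners_props:
  assumes [measurable]: "A \<in> sets borel" and bd: "A \<subseteq> ball 0 R" and es: "\<forall>e\<in>set es. norm e = 1"
  shows "steiners es A \<in> sets borel" "steiners es A \<subseteq> ball 0 R"
    "emeasure lborel (steiners es A) = emeasure lborel A"
proof -
  have "steiners es A \<in> sets borel \<and> steiners es A \<subseteq> ball 0 R \<and>
    emeasure lborel (steiners es A) = emeasure lborel A"
    using es
  proof (induction es)
    case (Cons e es)
    then show ?case
      using steiner_subset_ball[of e "steiners es A" R] emeasure_steiner[of e "steiners es A" R] by auto
  qed (use assms in auto)
  then show "steiners es A \<in> sets borel" "steiners es A \<subseteq> ball 0 R"
    "emeasure lborel (steiners es A) = emeasure lborel A" by auto
qed

text \<open>
  One sequence of symmetrizations works for all sets of a finite family. If the infimum \<open>d\<close> of the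
  total defect were positive, then a nearly optimal sequence would leave some set with defect at
  least \<open>d\<close> divided by the size of the family, and one more symmetrization, which increases no other
  defect, would bring the total below \<open>d\<close>.
\<close>

lemma steiners_approx:
  fixes A :: "'i \<Rightarrow> 'a::euclidean_space set"
  assumes I: "finite I" "I \<noteq> {}" and meas: "\<And>i. i \<in> I \<Longrightarrow> A i \<in> sets borel"
    and bd: "\<And>i. i \<in> I \<Longrightarrow> A i \<subseteq> ball 0 R" and R: "0 < R" and \<epsilon>: "0 < (\<epsilon>::real)"
  shows "\<exists>es. (\<forall>e\<in>set es. norm e = 1) \<and> (\<Sum>i\<in>I. measure lborel (steiners es (A i) - rearr (A i))) < \<epsilon>"
proof -
  define W where "W = {es :: 'a list. \<forall>e\<in>set es. norm e = 1}"
  define D where "D es = (\<Sum>i\<in>I. measure lborel (steiners es (A i) - rearr (A i)))" for es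
  define d where "d = (INF es\<in>W. D es)"
  have W: "W \<noteq> {}" by (auto simp: W_def intro: exI[of _ "[]"])
  have D0: "0 \<le> D es" for es by (simp add: D_def sum_nonneg)
  have bdd: "bdd_below (D ` W)" by (rule bdd_belowI[of _ 0]) (auto simp: D0)
  have "\<not> 0 < d"
  proof
    assume d: "0 < d"
    define V where "V = measure lborel (ball (0::'a) (2 * R))"
    have V: "0 < V"
      unfolding V_def using R by (simp add: content_ball unit_ball_vol_pos)
    define \<kappa> where "\<kappa> = (d / card I)\<^sup>2 / (2 * V)"
    have cI: "0 < card I" using I by (simp add: card_gt_0_iff)
    have \<kappa>: "0 < \<kappa>" using d V cI by (simp add: \<kappa>_def)
    have "\<exists>es\<in>W. D es < d + \<kappa>"
      using cINF_less_iff[OF W bdd, of "d + \<kappa>"] \<kappa> by (simp add: d_def)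
    then obtain es where es: "es \<in> W" "D es < d + \<kappa>" by auto
    have "d \<le> D es" unfolding d_def by (rule cINF_lower[OF bdd es(1)])
    have S: "steiners es (A i) \<in> sets borel" "steiners es (A i) \<subseteq> ball 0 R"
      "rearr (steiners es (A i)) = rearr (A i)" if "i \<in> I" for i
      using steiners_props[OF meas[OF that] bd[OF that], of es] es(1) rearr_cong[of "steiners es (A i)" "A i"]
      by (auto simp: W_def)
    obtain i where i: "i \<in> I" "d / card I \<le> measure lborel (steiners es (A i) - rearr (A i))"
    proof -
      have "\<exists>i\<in>I. d / card I \<le> measure lborel (steiners es (A i) - rearr (A i))"
      proof (rule ccontr)
        assume "\<not> ?thesis"
        then have "D es < (\<Sum>i\<in>I. d / card I)"
          unfolding D_def using I by (intro sum_strict_mono) (auto simp: not_le)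
        also have "\<dots> = d" using cI by simp
        finally show False using \<open>d \<le> D es\<close> by simp
      qed
      then show thesis using that by blast
    qed
    have "0 < d / card I" using d cI by simp
    then obtain e where e: "norm e = 1" "measure lborel (steiner e (steiners es (A i)) - rearr (A i)) \<le>
        measure lborel (steiners es (A i) - rearr (A i)) - \<kappa>"
      using steiner_gain[OF S(1,2) R, of i "d / card I"] i S(3)[of i]
      unfolding \<kappa>_def V_def by auto
    have le: "measure lborel (steiner e (steiners es (A j)) - rearr (A j)) \<le>
        measure lborel (steiners es (A j) - rearr (A j))" if "j \<in> I" for j
      using steiner_defect[OF e(1) S(1,2)[OF that] R, of 0] S(3)[OF that]
      by (smt (verit) measure_nonneg)
    have "D (e # es) \<le> D es - \<kappa>"
    proof -
      have "D (e # es) = measure lborel (steiner e (steiners es (A i)) - rearr (A i)) +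
          (\<Sum>j\<in>I - {i}. measure lborel (steiner e (steiners es (A j)) - rearr (A j)))"
        unfolding D_def using I i by (simp add: sum.remove)
      also have "\<dots> \<le> (measure lborel (steiners es (A i) - rearr (A i)) - \<kappa>) +
          (\<Sum>j\<in>I - {i}. measure lborel (steiners es (A j) - rearr (A j)))"
        by (intro add_mono e sum_mono le) auto
      also have "\<dots> = D es - \<kappa>"
        unfolding D_def using I i by (simp add: sum.remove)
      finally show ?thesis .
    qed
    moreover have "e # es \<in> W" using es e by (auto simp: W_def)
    then have "d \<le> D (e # es)" unfolding d_def by (rule cINF_lower[OF bdd])
    ultimately show False using es by simp
  qed
  then have "(INF es\<in>W. D es) < \<epsilon>" using \<epsilon> by (simp add: d_def)
  then show ?thesis
    using cINF_less_iff[OF W bdd] by (auto simp: W_def D_def)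
qed

lemma riesz_form_steiners:
  assumes [measurable]: "A \<in> sets borel" "B \<in> sets borel" "C \<in> sets borel"
    and bd: "A \<subseteq> ball 0 R" "B \<subseteq> ball 0 R" "C \<subseteq> ball 0 R" and es: "\<forall>e\<in>set es. norm e = 1"
  shows "riesz_form A B C \<le> riesz_form (steiners es A) (steiners es B) (steiners es C)"
  using es
proof (induction es)
  case (Cons e es)
  then have "riesz_form A B C \<le> riesz_form (steiners es A) (steiners es B) (steiners es C)" by simp
  also have "\<dots> \<le> riesz_form (steiners (e # es) A) (steiners (e # es) B) (steiners (e # es) C)"
    unfolding steiners_simps using Cons.prems bd
    by (intro riesz_form_le_steiner[where R=R] steiners_props) auto
  finally show ?case .
qed simp

lemma riesz_form_mono:
  assumes "A \<subseteq> A'" "B \<subseteq> B'" "C \<subseteq> C'"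
  shows "riesz_form A B C \<le> riesz_form A' B' C'"
  unfolding riesz_form_def using assms
  by (intro nn_integral_mono) (auto split: split_indicator)

lemma riesz_form_le_split1:
  assumes [measurable]: "A \<in> sets borel" "A' \<in> sets borel" "B \<in> sets borel" "C \<in> sets borel"
  shows "riesz_form A B C \<le> riesz_form A' B C + riesz_form (A - A') B C"
proof -
  have "riesz_form A B C \<le> (\<integral>\<^sup>+x. \<integral>\<^sup>+y. indicator A' x * indicator B y * indicator C (x + y) +
     indicator (A - A') x * indicator B y * indicator C (x + y) \<partial>lborel \<partial>lborel)"
    unfolding riesz_form_def by (intro nn_integral_mono) (auto split: split_indicator)
  also have "\<dots> = riesz_form A' B C + riesz_form (A - A') B C"
    unfolding riesz_form_def by (simp add: nn_integral_add)
  finally show ?thesis .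
qed

lemma riesz_form_le_split3:
  assumes [measurable]: "A \<in> sets borel" "C' \<in> sets borel" "B \<in> sets borel" "C \<in> sets borel"
  shows "riesz_form A B C \<le> riesz_form A B C' + riesz_form A B (C - C')"
proof -
  have "riesz_form A B C \<le> (\<integral>\<^sup>+x. \<integral>\<^sup>+y. indicator A x * indicator B y * indicator C' (x + y) +
     indicator A x * indicator B y * indicator (C - C') (x + y) \<partial>lborel \<partial>lborel)"
    unfolding riesz_form_def by (intro nn_integral_mono) (auto split: split_indicator)
  also have "\<dots> = riesz_form A B C' + riesz_form A B (C - C')"
    unfolding riesz_form_def by (simp add: nn_integral_add)
  finally show ?thesis .
qed

lemma riesz_form_perturb:
  assumes [measurable]: "A \<in> sets borel" "B \<in> sets borel" "C \<in> sets borel"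
    "A' \<in> sets borel" "B' \<in> sets borel" "C' \<in> sets borel"
  shows "riesz_form A B C \<le> riesz_form A' B' C' + (emeasure lborel (A - A') * emeasure lborel B +
    emeasure lborel A' * emeasure lborel (B - B') + emeasure lborel A' * emeasure lborel (C - C'))"
proof -
  have "riesz_form A B C \<le> riesz_form A' B C + emeasure lborel (A - A') * emeasure lborel B"
    using riesz_form_le_split1[of A A' B C] riesz_form_le12[of "A - A'" B C] by (simp add: add_left_mono order_trans)
  also have "riesz_form A' B C \<le> riesz_form A' B' C + emeasure lborel A' * emeasure lborel (B - B')"
    using riesz_form_le_split1[of B B' A' C] riesz_form_le12[of A' "B - B'" C]
    by (simp add: riesz_form_commute[of _ A'] add_left_mono order_trans)
  also have "riesz_form A' B' C \<le> riesz_form A' B' C' + emeasure lborel A' * emeasure lborel (C - C')"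
    using riesz_form_le_split3[of A' C' B' C] riesz_form_le13[of A' B' "C - C'"] by (simp add: add_left_mono order_trans)
  finally show ?thesis by (simp add: ac_simps)
qed

lemma riesz_bounded:
  fixes A B C :: "'a::euclidean_space set"
  assumes [measurable]: "A \<in> sets borel" "B \<in> sets borel" "C \<in> sets borel"
    and bd: "A \<subseteq> ball 0 R" "B \<subseteq> ball 0 R" "C \<subseteq> ball 0 R" and R: "0 < R"
  shows "riesz_form A B C \<le> riesz_form (rearr A) (rearr B) (rearr C)"
proof (rule ennreal_le_epsilon)
  fix \<epsilon> :: real assume \<epsilon>: "0 < \<epsilon>"
  have fin: "emeasure lborel A < \<infinity>" "emeasure lborel B < \<infinity>"
    using finite_emeasure_subset_ball bd by blast+
  define a b where "a = measure lborel A" and "b = measure lborel B"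
  have ab: "emeasure lborel A = ennreal a" "emeasure lborel B = ennreal b"
    using fin by (auto simp: a_def b_def emeasure_eq_ennreal_measure)
  define \<delta> where "\<delta> = \<epsilon> / (a + b + 1)"
  have ab0: "0 \<le> a" "0 \<le> b" by (auto simp: a_def b_def)
  have \<delta>: "0 < \<delta>" using \<epsilon> ab0 by (simp add: \<delta>_def)
  define F where "F i = (if i = 0 then A else if i = Suc 0 then B else C)" for i
  obtain es where es: "\<forall>e\<in>set es. norm e = 1"
    and lt: "(\<Sum>i\<in>{0,1,2}. measure lborel (steiners es (F i) - rearr (F i))) < \<delta>"
  proof -
    have "F i \<in> sets borel \<and> F i \<subseteq> ball 0 R" for i
      using bd by (simp add: F_def)
    then show thesis
      using steiners_approx[of "{0,1,2::nat}" F R \<delta>] R \<delta> that by blast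
  qed
  let ?A = "steiners es A" and ?B = "steiners es B" and ?C = "steiners es C"
  have SA: "?A \<in> sets borel" "?A \<subseteq> ball 0 R" "emeasure lborel ?A = ennreal a"
    and SB: "?B \<in> sets borel" "?B \<subseteq> ball 0 R" "emeasure lborel ?B = ennreal b"
    and SC: "?C \<in> sets borel" "?C \<subseteq> ball 0 R"
    using steiners_props[OF _ bd(1) es] steiners_props[OF _ bd(2) es] steiners_props[OF _ bd(3) es] ab by auto
  define u v w where "u = measure lborel (?A - rearr A)" and "v = measure lborel (?B - rearr B)"
    and "w = measure lborel (?C - rearr C)"
  have uvw: "u + v + w < \<delta>" using lt by (simp add: F_def u_def v_def w_def add.assoc)
  have e: "emeasure lborel (?A - rearr A) = ennreal u" "emeasure lborel (?B - rearr B) = ennreal v"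
    "emeasure lborel (?C - rearr C) = ennreal w"
  proof -
    have "emeasure lborel (S - T) = ennreal (measure lborel (S - T))" if "S \<subseteq> ball 0 R" for S T :: "'a set"
    proof -
      have "S - T \<subseteq> ball 0 R" using that by auto
      from finite_emeasure_subset_ball[OF this] show ?thesis
        by (intro emeasure_eq_ennreal_measure) auto
    qed
    then show "emeasure lborel (?A - rearr A) = ennreal u" "emeasure lborel (?B - rearr B) = ennreal v"
      "emeasure lborel (?C - rearr C) = ennreal w"
      unfolding u_def v_def w_def using SA SB SC by auto
  qed
  have "u * b + a * v + a * w \<le> (a + b + 1) * (u + v + w)"
    using ab0 by (simp add: algebra_simps u_def v_def w_def)
  also have "\<dots> \<le> (a + b + 1) * \<delta>"
    using uvw ab0 by (intro mult_left_mono) auto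
  also have "\<dots> = \<epsilon>" using ab0 by (simp add: \<delta>_def)
  finally have *: "u * b + a * v + a * w \<le> \<epsilon>" .
  have "riesz_form A B C \<le> riesz_form ?A ?B ?C"
    by (rule riesz_form_steiners[OF assms(1-6) es])
  also have "\<dots> \<le> riesz_form (rearr A) (rearr B) (rearr C) +
     (ennreal u * ennreal b + ennreal a * ennreal v + ennreal a * ennreal w)"
    using riesz_form_perturb[OF SA(1) SB(1) SC(1), of "rearr A" "rearr B" "rearr C"] SA SB e
     emeasure_rearr[OF fin(1)] ab by simp
  also have "ennreal u * ennreal b + ennreal a * ennreal v + ennreal a * ennreal w = ennreal (u * b + a * v + a * w)"
    using ab0 by (simp add: ennreal_mult[symmetric] ennreal_plus[symmetric] u_def v_def w_def del: ennreal_plus)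
  also have "\<dots> \<le> ennreal \<epsilon>" using * by (rule ennreal_leI)
  finally show "riesz_form A B C \<le> riesz_form (rearr A) (rearr B) (rearr C) + ennreal \<epsilon>"
    by (simp add: add_left_mono)
qed

lemma tail_tendsto_0:
  fixes A :: "'a::euclidean_space set"
  assumes [measurable]: "A \<in> sets borel" and fin: "emeasure lborel A < \<infinity>"
  shows "(\<lambda>n. emeasure lborel (A - ball 0 (real n))) \<longlonglongrightarrow> 0"
proof -
  have "(\<lambda>n. emeasure lborel (A - ball 0 (real n))) \<longlonglongrightarrow> emeasure lborel (\<Inter>n. A - ball 0 (real n))"
  proof (rule Lim_emeasure_decseq)
    show "emeasure lborel (A - ball 0 (real n)) \<noteq> \<infinity>" for n
      using fin emeasure_mono[of "A - ball 0 (real n)" A lborel] by (auto simp: top_unique)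
  qed (auto simp: decseq_def)
  moreover have "(\<Inter>n. A - ball 0 (real n)) = {}"
  proof -
    have "x \<notin> (\<Inter>n. A - ball 0 (real n))" for x
      using reals_Archimedean2[of "norm x"] by (auto simp del: INT_simps)
    then show ?thesis by blast
  qed
  ultimately show ?thesis by (simp del: INT_simps)
qed

theorem riesz_rearrangement:
  fixes A B C :: "'a::euclidean_space set"
  assumes [measurable]: "A \<in> sets borel" "B \<in> sets borel" "C \<in> sets borel"
    and fin: "emeasure lborel A < \<infinity>" "emeasure lborel B < \<infinity>" "emeasure lborel C < \<infinity>"
  shows "riesz_form A B C \<le> riesz_form (rearr A) (rearr B) (rearr C)"
proof -
  let ?b = "\<lambda>n. ball (0::'a) (real n)"
  have "riesz_form A B C \<le> riesz_form (rearr A) (rearr B) (rearr C) + (emeasure lborel (A - ?b n) * emeasure lborel B +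
    emeasure lborel A * emeasure lborel (B - ?b n) + emeasure lborel A * emeasure lborel (C - ?b n))"
    if "0 < n" for n
  proof -
    have "riesz_form A B C \<le> riesz_form (A \<inter> ?b n) (B \<inter> ?b n) (C \<inter> ?b n) +
      (emeasure lborel (A - A \<inter> ?b n) * emeasure lborel B +
    emeasure lborel (A \<inter> ?b n) * emeasure lborel (B - B \<inter> ?b n) +
    emeasure lborel (A \<inter> ?b n) * emeasure lborel (C - C \<inter> ?b n))"
      by (rule riesz_form_perturb) measurable
    also have "riesz_form (A \<inter> ?b n) (B \<inter> ?b n) (C \<inter> ?b n) \<le>
        riesz_form (rearr (A \<inter> ?b n)) (rearr (B \<inter> ?b n)) (rearr (C \<inter> ?b n))"
      using that by (intro riesz_bounded[where R="real n"]) auto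
    also have "\<dots> \<le> riesz_form (rearr A) (rearr B) (rearr C)"
      using fin by (intro riesz_form_mono rearr_mono measure_mono_fmeasurable) (auto simp: fmeasurable_def)
    also have "emeasure lborel (A \<inter> ?b n) \<le> emeasure lborel A"
      by (rule emeasure_mono) auto
    finally show ?thesis
      by (simp add: Diff_Int add_left_mono add_mono mult_right_mono)
  qed
  moreover have "(\<lambda>n. riesz_form (rearr A) (rearr B) (rearr C) + (emeasure lborel (A - ?b n) * emeasure lborel B +
    emeasure lborel A * emeasure lborel (B - ?b n) + emeasure lborel A * emeasure lborel (C - ?b n)))
     \<longlonglongrightarrow> riesz_form (rearr A) (rearr B) (rearr C) + (0 * emeasure lborel B + emeasure lborel A * 0 + emeasure lborel A * 0)"
    using fin by (intro tendsto_add tendsto_mult_ennreal tendsto_const tail_tendsto_0) auto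
  ultimately show ?thesis
    by (intro tendsto_lowerbound[where F=sequentially and f="\<lambda>n. riesz_form (rearr A) (rearr B) (rearr C) + (emeasure lborel (A - ?b n) * emeasure lborel B +
    emeasure lborel A * emeasure lborel (B - ?b n) + emeasure lborel A * emeasure lborel (C - ?b n))"])
      (auto intro!: eventually_sequentiallyI[of 1])
qed

section \<open>Densities compared with radially decreasing densities\<close>

text \<open>
  Radially symmetric and nonincreasing in the distance from the origin.
\<close>

definition radial_decr :: "('a::euclidean_space \<Rightarrow> ennreal) \<Rightarrow> bool" where
  "radial_decr q \<longleftrightarrow> (\<forall>x y. norm x \<le> norm y \<longrightarrow> q y \<le> q x)"

text \<open>
  The comparison of concentration used throughout; \<open>q\<close> is meant to be radially decreasing, so that
  \<open>rearr D\<close> captures the largest possible mass of \<open>q\<close> among all sets of the volume of \<open>D\<close>.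
\<close>

definition less_spread :: "('a::euclidean_space \<Rightarrow> ennreal) \<Rightarrow> ('a \<Rightarrow> ennreal) \<Rightarrow> bool" where
  "less_spread p q \<longleftrightarrow> (\<forall>D. D \<in> sets borel \<longrightarrow> emeasure lborel D < \<infinity> \<longrightarrow>
     (\<integral>\<^sup>+x\<in>D. p x \<partial>lborel) \<le> (\<integral>\<^sup>+x\<in>rearr D. q x \<partial>lborel))"

lemma radial_decrD: "radial_decr q \<Longrightarrow> norm x \<le> norm y \<Longrightarrow> q y \<le> q x"
  by (simp add: radial_decr_def)

lemma radial_decr_cong: "radial_decr q \<Longrightarrow> norm x = norm y \<Longrightarrow> q x = q y"
  by (simp add: radial_decr_def order_antisym)

lemma level_finite:
  fixes p :: "'a::euclidean_space \<Rightarrow> ennreal"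
  assumes [measurable]: "p \<in> borel_measurable borel" and fin: "(\<integral>\<^sup>+x. p x \<partial>lborel) < \<infinity>" and t: "0 < t"
  shows "emeasure lborel {x. t < p x} < \<infinity>"
proof -
  have [measurable]: "{x. t < p x} \<in> sets borel" by measurable
  have "t * emeasure lborel {x. t < p x} = (\<integral>\<^sup>+x. t * indicator {x. t < p x} x \<partial>lborel)"
    by (simp add: nn_integral_cmult_indicator)
  also have "\<dots> \<le> (\<integral>\<^sup>+x. p x \<partial>lborel)"
    by (intro nn_integral_mono) (auto split: split_indicator)
  finally have "t * emeasure lborel {x. t < p x} < \<infinity>" using fin by simp
  then show ?thesis using t by (auto simp: ennreal_mult_less_top less_top)
qed

text \<open>
  Levels are real numbers, so an infinite value \<open>u\<close> exceeds all of them.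
\<close>

lemma level_integral:
  fixes u :: ennreal
  shows "(\<integral>\<^sup>+s\<in>{0<..}. indicator {s. ennreal s < u} s \<partial>lborel) = u"
proof (cases u)
  case (real c)
  have "(indicator {s. ennreal s < u} s * indicator {0<..} s :: ennreal) = indicator {0<..<c} s" for s
    using real by (auto simp: ennreal_less_iff split: split_indicator)
  then show ?thesis using real by simp
next
  case top
  have "(indicator {s. ennreal s < u} s * indicator {0<..} s :: ennreal) = indicator {0<..} s" for s
    using top by (auto split: split_indicator)
  moreover have "emeasure lborel {0::real<..} = \<infinity>"
  proof (rule ccontr)
    assume "emeasure lborel {0::real<..} \<noteq> \<infinity>"
    then obtain n where "emeasure lborel {0::real<..} < of_nat n"
      using ennreal_Ex_less_of_nat[of "emeasure lborel {0::real<..}"] by (auto simp: less_top)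
    moreover have "emeasure lborel {0<..<real n} \<le> emeasure lborel {0::real<..}"
      by (intro emeasure_mono) auto
    ultimately show False by (simp add: ennreal_of_nat_eq_real_of_nat not_le[symmetric])
  qed
  ultimately show ?thesis using top by simp
qed

lemma level_integral_above:
  fixes u :: ennreal
  assumes "0 \<le> t"
  shows "(\<integral>\<^sup>+s\<in>{t<..}. indicator {s. ennreal s < u} s \<partial>lborel) = u - ennreal t"
proof -
  have "(\<integral>\<^sup>+s\<in>{t<..}. indicator {s. ennreal s < u} s \<partial>lborel) =
     (\<integral>\<^sup>+s. indicator {s. ennreal s < u} (t + s) * indicator {t<..} (t + s) \<partial>lborel)"
    by (rule nn_integral_lborel_plus[symmetric]) measurable
  also have "\<dots> = (\<integral>\<^sup>+s\<in>{0<..}. indicator {s. ennreal s < u - ennreal t} s \<partial>lborel)"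
    using assms by (intro nn_integral_cong)
      (auto split: split_indicator simp: ennreal_plus less_diff_eq_ennreal add.commute)
  finally show ?thesis by (simp only: level_integral)
qed

lemma layer_cake:
  fixes p k :: "'a::euclidean_space \<Rightarrow> ennreal"
  assumes [measurable]: "p \<in> borel_measurable borel" "k \<in> borel_measurable borel"
  shows "(\<integral>\<^sup>+x. p x * k x \<partial>lborel) = (\<integral>\<^sup>+s\<in>{0<..}. (\<integral>\<^sup>+x\<in>{x. ennreal s < k x}. p x \<partial>lborel) \<partial>lborel)"
proof -
  have "(\<integral>\<^sup>+x. p x * k x \<partial>lborel) =
    (\<integral>\<^sup>+x. \<integral>\<^sup>+s. p x * (indicator {s. ennreal s < k x} s * indicator {0<..} s) \<partial>lborel \<partial>lborel)"
    by (simp add: nn_integral_cmult level_integral)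
  also have "\<dots> = (\<integral>\<^sup>+s. \<integral>\<^sup>+x. p x * (indicator {s. ennreal s < k x} s * indicator {0<..} s) \<partial>lborel \<partial>lborel)"
    by (rule lborel_pair.Fubini') measurable
  also have "\<dots> = (\<integral>\<^sup>+s\<in>{0<..}. (\<integral>\<^sup>+x\<in>{x. ennreal s < k x}. p x \<partial>lborel) \<partial>lborel)"
  proof (rule nn_integral_cong)
    fix s :: real
    have "(\<integral>\<^sup>+x. p x * (indicator {s. ennreal s < k x} s * indicator {0<..} s) \<partial>lborel) =
      (\<integral>\<^sup>+x. p x * indicator {x. ennreal s < k x} x * indicator {0<..} s \<partial>lborel)"
      by (intro nn_integral_cong) (simp split: split_indicator)
    also have "\<dots> = (\<integral>\<^sup>+x\<in>{x. ennreal s < k x}. p x \<partial>lborel) * indicator {0<..} s"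
      by (rule nn_integral_multc) measurable
    finally show "(\<integral>\<^sup>+x. p x * (indicator {s. ennreal s < k x} s * indicator {0<..} s) \<partial>lborel) =
      (\<integral>\<^sup>+x\<in>{x. ennreal s < k x}. p x \<partial>lborel) * indicator {0<..} s" .
  qed
  finally show ?thesis .
qed

lemma measurable_level [measurable]:
  fixes k :: "'a::euclidean_space \<Rightarrow> ennreal"
  assumes [measurable]: "k \<in> borel_measurable borel"
  shows "(\<lambda>s. emeasure lborel {x. ennreal s < k x}) \<in> borel_measurable borel"
proof -
  have "emeasure lborel {x. ennreal s < k x} = (\<integral>\<^sup>+x. indicator {x. ennreal s < k x} x \<partial>lborel)" for s
    by simp
  moreover have "(\<lambda>s. \<integral>\<^sup>+x. indicator {x. ennreal s < k x} x \<partial>lborel) \<in> borel_measurable borel"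
    by measurable
  ultimately show ?thesis by simp
qed

text \<open>
  For \<open>D = {p > t}\<close> the excess of \<open>p\<close> over \<open>t\<close> equals \<open>\<integral>\<^sub>D p - t \<bar>D\<bar>\<close>. Subtraction in \<open>ennreal\<close> is
  truncated, so the integrands are positive parts.
\<close>

lemma less_spread_excess:
  fixes p q :: "'a::euclidean_space \<Rightarrow> ennreal"
  assumes [measurable]: "p \<in> borel_measurable borel" "q \<in> borel_measurable borel"
    and ls: "less_spread p q" and fin: "(\<integral>\<^sup>+x. p x \<partial>lborel) < \<infinity>" and t: "0 < t"
  shows "(\<integral>\<^sup>+x. p x - ennreal t \<partial>lborel) \<le> (\<integral>\<^sup>+x. q x - ennreal t \<partial>lborel)"
proof -
  define D where "D = {x. ennreal t < p x}"
  have [measurable]: "D \<in> sets borel" unfolding D_def by measurable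
  have D: "emeasure lborel D < \<infinity>"
    unfolding D_def using t by (intro level_finite fin) auto
  have "(\<integral>\<^sup>+x. p x - ennreal t \<partial>lborel) + ennreal t * emeasure lborel D =
      (\<integral>\<^sup>+x. (p x - ennreal t) + ennreal t * indicator D x \<partial>lborel)"
    by (simp add: nn_integral_add nn_integral_cmult_indicator)
  also have "\<dots> = (\<integral>\<^sup>+x\<in>D. p x \<partial>lborel)"
  proof (rule nn_integral_cong)
    fix x
    show "(p x - ennreal t) + ennreal t * indicator D x = p x * indicator D x"
      by (cases "x \<in> D") (auto simp: D_def diff_add_cancel_ennreal not_less diff_eq_0_iff_ennreal intro: le_less_trans[OF _ ennreal_less_top])
  qed
  also have "\<dots> \<le> (\<integral>\<^sup>+x\<in>rearr D. q x \<partial>lborel)"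
    using ls D by (simp add: less_spread_def)
  also have "\<dots> \<le> (\<integral>\<^sup>+x. (q x - ennreal t) + ennreal t * indicator (rearr D) x \<partial>lborel)"
  proof (rule nn_integral_mono)
    fix x
    show "q x * indicator (rearr D) x \<le> (q x - ennreal t) + ennreal t * indicator (rearr D) x"
      by (auto simp: diff_add_self_ennreal split: split_indicator)
  qed
  also have "\<dots> = (\<integral>\<^sup>+x. q x - ennreal t \<partial>lborel) + ennreal t * emeasure lborel D"
    using emeasure_rearr[OF D] by (simp add: nn_integral_add nn_integral_cmult_indicator)
  finally show ?thesis
    using D by (auto simp: add.commute[of _ "ennreal t * _"] ennreal_mult_eq_top_iff)
qed

text \<open>
  For radially decreasing \<open>q\<close> the superlevel set \<open>E\<close> is, up to its boundary, a ball about the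
  origin. The left-hand side is the supremum of the integrals of \<open>k\<close> over sets of volume
  \<open>\<bar>E\<bar>\<close>. It is bounded through \<open>\<integral> min \<bar>{k > s}\<bar> \<bar>E\<bar> ds \<le> t \<bar>E\<bar> + \<integral> (k - t)\<^sub>+\<close>, with \<open>t\<close> the supremum
  of \<open>h\<close> outside \<open>E\<close>; for this \<open>t\<close> the integral of \<open>h\<close> over \<open>E\<close> is exactly \<open>t \<bar>E\<bar> + \<integral> (h - t)\<^sub>+\<close>.
\<close>

lemma radial_set_bathtub:
  fixes k h q :: "'a::euclidean_space \<Rightarrow> ennreal"
  assumes [measurable]: "k \<in> borel_measurable borel" "h \<in> borel_measurable borel" "q \<in> borel_measurable borel"
    and ls: "less_spread k h" and fin: "(\<integral>\<^sup>+x. k x \<partial>lborel) < \<infinity>"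
    and h: "radial_decr h" and q: "radial_decr q"
    and E: "E = {x. r < q x}" and m: "emeasure lborel E < \<infinity>"
  shows "(\<integral>\<^sup>+s\<in>{0<..}. min (emeasure lborel {x. ennreal s < k x}) (emeasure lborel E) \<partial>lborel) \<le> (\<integral>\<^sup>+x\<in>E. h x \<partial>lborel)"
proof -
  have [measurable]: "E \<in> sets borel" unfolding E by measurable
  define \<tau> where "\<tau> = (SUP x\<in>-E. h x)"
  have out: "h x \<le> \<tau>" if "x \<notin> E" for x
    unfolding \<tau>_def using that by (intro SUP_upper) auto
  have inn: "\<tau> \<le> h y" if "y \<in> E" for y
    unfolding \<tau>_def
  proof (rule SUP_least)
    fix x assume "x \<in> - E"
    then have "\<not> norm x \<le> norm y" using that radial_decrD[OF q, of x y] by (auto simp: E)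
    then show "h x \<le> h y" by (intro radial_decrD[OF h]) auto
  qed
  show ?thesis
  proof (cases \<tau>)
    case top
    show ?thesis
    proof (cases "emeasure lborel E = 0")
      case True
      then show ?thesis by simp
    next
      case False
      have "(\<integral>\<^sup>+x\<in>E. \<infinity> \<partial>lborel) \<le> (\<integral>\<^sup>+x\<in>E. h x \<partial>lborel)"
        using inn top by (intro nn_integral_mono) (auto split: split_indicator simp: top_unique)
      moreover have "(\<integral>\<^sup>+x\<in>E. \<infinity> \<partial>lborel) = \<infinity>"
        using False by (subst nn_integral_cmult_indicator) (auto simp: ennreal_top_mult)
      ultimately show ?thesis by (simp add: top_unique)
    qed
  next
    case (real t)
    obtain c where c: "emeasure lborel E = ennreal c" "0 \<le> c"
      using m by (cases "emeasure lborel E") auto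
    show ?thesis
    proof (rule ennreal_le_epsilon)
      fix \<epsilon>' :: real assume "0 < \<epsilon>'"
      \<comment> \<open>The comparison of excesses needs a positive level, whereas \<open>t\<close> may be zero; hence the level
        \<open>t + \<epsilon>\<close>.\<close>
      define \<epsilon> where "\<epsilon> = \<epsilon>' / (c + 1)"
      have \<epsilon>: "0 < \<epsilon>" using \<open>0 < \<epsilon>'\<close> c by (simp add: \<epsilon>_def)
      have "\<epsilon> * c \<le> \<epsilon>'"
        using \<open>0 < \<epsilon>'\<close> c by (simp add: \<epsilon>_def field_simps)
      let ?N = "\<lambda>s. emeasure lborel {x. ennreal s < k x}"
      have "(\<integral>\<^sup>+s\<in>{0<..}. min (?N s) (emeasure lborel E) \<partial>lborel) \<le>
         (\<integral>\<^sup>+s. ennreal c * indicator {0..t+\<epsilon>} s + ?N s * indicator {t+\<epsilon><..} s \<partial>lborel)"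
        using c by (intro nn_integral_mono) (auto split: split_indicator)
      also have "\<dots> = ennreal c * ennreal (t + \<epsilon>) + (\<integral>\<^sup>+s\<in>{t+\<epsilon><..}. ?N s \<partial>lborel)"
        using real \<epsilon> by (simp add: nn_integral_add nn_integral_cmult_indicator)
      also have "(\<integral>\<^sup>+s\<in>{t+\<epsilon><..}. ?N s \<partial>lborel) =
         (\<integral>\<^sup>+s. \<integral>\<^sup>+x. indicator {s. ennreal s < k x} s * indicator {t+\<epsilon><..} s \<partial>lborel \<partial>lborel)"
      proof (rule nn_integral_cong)
        fix s :: real
        have "(\<integral>\<^sup>+x. indicator {s. ennreal s < k x} s * indicator {t+\<epsilon><..} s \<partial>lborel) =
          (\<integral>\<^sup>+x. indicator {x. ennreal s < k x} x * indicator {t+\<epsilon><..} s \<partial>lborel)"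
          by (intro nn_integral_cong) (simp split: split_indicator)
        also have "\<dots> = ?N s * indicator {t+\<epsilon><..} s"
          by (subst nn_integral_multc) auto
        finally show "?N s * indicator {t+\<epsilon><..} s =
          (\<integral>\<^sup>+x. indicator {s. ennreal s < k x} s * indicator {t+\<epsilon><..} s \<partial>lborel)" ..
      qed
      also have "\<dots> = (\<integral>\<^sup>+x. \<integral>\<^sup>+s. indicator {s. ennreal s < k x} s * indicator {t+\<epsilon><..} s \<partial>lborel \<partial>lborel)"
        by (rule lborel_pair.Fubini') measurable
      also have "\<dots> = (\<integral>\<^sup>+x. k x - ennreal (t + \<epsilon>) \<partial>lborel)"
        using real \<epsilon> by (simp add: level_integral_above)
      also have "\<dots> \<le> (\<integral>\<^sup>+x. h x - ennreal (t + \<epsilon>) \<partial>lborel)"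
        using real \<epsilon> by (intro less_spread_excess ls fin) auto
      also have "\<dots> \<le> (\<integral>\<^sup>+x\<in>E. h x - ennreal t \<partial>lborel)"
      proof (rule nn_integral_mono)
        fix x
        show "h x - ennreal (t + \<epsilon>) \<le> (h x - ennreal t) * indicator E x"
        proof (cases "x \<in> E")
          case True
          then show ?thesis using \<epsilon> by (auto intro!: ennreal_minus_mono ennreal_leI)
        next
          case False
          have "h x \<le> ennreal (t + \<epsilon>)"
            using out[OF False] real \<epsilon> by (auto intro: order_trans ennreal_leI)
          then show ?thesis using False by (simp add: diff_eq_0_iff_ennreal le_less_trans[OF _ ennreal_less_top])
        qed
      qed
      finally have "(\<integral>\<^sup>+s\<in>{0<..}. min (?N s) (emeasure lborel E) \<partial>lborel) \<le>
        ennreal c * ennreal (t + \<epsilon>) + (\<integral>\<^sup>+x\<in>E. h x - ennreal t \<partial>lborel)"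
        by (simp add: add_left_mono)
      also have "ennreal c * ennreal (t + \<epsilon>) = ennreal (\<epsilon> * c) + ennreal t * emeasure lborel E"
        using c real \<epsilon> by (simp add: ennreal_mult[symmetric] ennreal_plus[symmetric] algebra_simps del: ennreal_plus)
      also have "ennreal (\<epsilon> * c) + ennreal t * emeasure lborel E + (\<integral>\<^sup>+x\<in>E. h x - ennreal t \<partial>lborel) =
        ennreal (\<epsilon> * c) + (\<integral>\<^sup>+x. ennreal t * indicator E x + (h x - ennreal t) * indicator E x \<partial>lborel)"
        by (simp add: nn_integral_add nn_integral_cmult_indicator add.assoc)
      also have "(\<integral>\<^sup>+x. ennreal t * indicator E x + (h x - ennreal t) * indicator E x \<partial>lborel) = (\<integral>\<^sup>+x\<in>E. h x \<partial>lborel)"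
        using inn real by (intro nn_integral_cong) (auto split: split_indicator simp: add_diff_inverse_ennreal add.commute)
      also have "ennreal (\<epsilon> * c) \<le> ennreal \<epsilon>'"
        using \<open>\<epsilon> * c \<le> \<epsilon>'\<close> by (rule ennreal_leI)
      finally show "(\<integral>\<^sup>+s\<in>{0<..}. min (?N s) (emeasure lborel E) \<partial>lborel) \<le> (\<integral>\<^sup>+x\<in>E. h x \<partial>lborel) + ennreal \<epsilon>'"
        by (simp add: add.commute add_right_mono)
    qed
  qed
qed

text \<open>
  Level sets of \<open>p\<close> and \<open>k\<close> overlap at most in the smaller of their volumes. The two comparisons
  are used one after the other, first for \<open>p\<close> on the level sets of \<open>k\<close>, then for \<open>k\<close> on those of \<open>q\<close>.
\<close>

lemma less_spread_pairing:
  fixes p q k h :: "'a::euclidean_space \<Rightarrow> ennreal"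
  assumes meas [measurable]: "p \<in> borel_measurable borel" "q \<in> borel_measurable borel"
      "k \<in> borel_measurable borel" "h \<in> borel_measurable borel"
    and pq: "less_spread p q" and kh: "less_spread k h"
    and fin: "(\<integral>\<^sup>+x. q x \<partial>lborel) < \<infinity>" "(\<integral>\<^sup>+x. k x \<partial>lborel) < \<infinity>"
    and h: "radial_decr h" and q: "radial_decr q"
  shows "(\<integral>\<^sup>+x. p x * k x \<partial>lborel) \<le> (\<integral>\<^sup>+x. q x * h x \<partial>lborel)"
proof -
  let ?N = "\<lambda>s. emeasure lborel {x. ennreal s < k x}"
  let ?M = "\<lambda>s. emeasure lborel {x. ennreal s < q x}"
  have "(\<integral>\<^sup>+x. p x * k x \<partial>lborel) = (\<integral>\<^sup>+s\<in>{0<..}. (\<integral>\<^sup>+x\<in>{x. ennreal s < k x}. p x \<partial>lborel) \<partial>lborel)"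
    by (rule layer_cake) measurable
  also have "\<dots> \<le> (\<integral>\<^sup>+s\<in>{0<..}. (\<integral>\<^sup>+r\<in>{0<..}. min (?N s) (?M r) \<partial>lborel) \<partial>lborel)"
  proof (rule nn_integral_mono)
    fix s :: real
    show "(\<integral>\<^sup>+x\<in>{x. ennreal s < k x}. p x \<partial>lborel) * indicator {0<..} s \<le>
        (\<integral>\<^sup>+r\<in>{0<..}. min (?N s) (?M r) \<partial>lborel) * indicator {0<..} s"
    proof (cases "0 < s")
      case True
      let ?S = "{x. ennreal s < k x}"
      have fS: "emeasure lborel ?S < \<infinity>" using True by (intro level_finite fin) auto
      have "(\<integral>\<^sup>+x\<in>?S. p x \<partial>lborel) \<le> (\<integral>\<^sup>+x\<in>rearr ?S. q x \<partial>lborel)"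
        using pq fS by (simp add: less_spread_def)
      also have "\<dots> = (\<integral>\<^sup>+x. indicator (rearr ?S) x * q x \<partial>lborel)"
        by (simp add: mult.commute)
      also have "\<dots> = (\<integral>\<^sup>+r\<in>{0<..}. (\<integral>\<^sup>+x\<in>{x. ennreal r < q x}. indicator (rearr ?S) x \<partial>lborel) \<partial>lborel)"
        by (rule layer_cake) measurable
      also have "\<dots> \<le> (\<integral>\<^sup>+r\<in>{0<..}. min (?N s) (?M r) \<partial>lborel)"
      proof (intro nn_integral_mono mult_right_mono min.boundedI)
        fix r :: real
        have [measurable]: "{x. ennreal r < q x} \<in> sets borel" by measurable
        have eq: "(\<integral>\<^sup>+x\<in>{x. ennreal r < q x}. indicator (rearr ?S) x \<partial>lborel) = emeasure lborel (rearr ?S \<inter> {x. ennreal r < q x})"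
          by (simp add: indicator_inter_arith[symmetric])
        show "(\<integral>\<^sup>+x\<in>{x. ennreal r < q x}. indicator (rearr ?S) x \<partial>lborel) \<le> ?N s"
          unfolding eq emeasure_rearr[OF fS, symmetric] by (intro emeasure_mono) auto
        show "(\<integral>\<^sup>+x\<in>{x. ennreal r < q x}. indicator (rearr ?S) x \<partial>lborel) \<le> ?M r"
          unfolding eq by (intro emeasure_mono) auto
      qed auto
      finally show ?thesis using True by simp
    qed simp
  qed
  also have "\<dots> = (\<integral>\<^sup>+s. \<integral>\<^sup>+r. min (?N s) (?M r) * indicator {0<..} r * indicator {0<..} s \<partial>lborel \<partial>lborel)"
    by (simp add: nn_integral_multc)
  also have "\<dots> = (\<integral>\<^sup>+r. \<integral>\<^sup>+s. min (?N s) (?M r) * indicator {0<..} r * indicator {0<..} s \<partial>lborel \<partial>lborel)"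
    by (rule lborel_pair.Fubini') measurable
  also have "\<dots> \<le> (\<integral>\<^sup>+r\<in>{0<..}. (\<integral>\<^sup>+x\<in>{x. ennreal r < q x}. h x \<partial>lborel) \<partial>lborel)"
  proof (rule nn_integral_mono)
    fix r :: real
    show "(\<integral>\<^sup>+s. min (?N s) (?M r) * indicator {0<..} r * indicator {0<..} s \<partial>lborel) \<le>
       (\<integral>\<^sup>+x\<in>{x. ennreal r < q x}. h x \<partial>lborel) * indicator {0<..} r"
    proof (cases "0 < r")
      case True
      have "(\<integral>\<^sup>+s\<in>{0<..}. min (?N s) (?M r) \<partial>lborel) \<le> (\<integral>\<^sup>+x\<in>{x. ennreal r < q x}. h x \<partial>lborel)"
        using True by (intro radial_set_bathtub[OF meas(3,4,2) kh fin(2) h q refl] level_finite fin) auto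
      then show ?thesis using True by simp
    qed simp
  qed
  also have "\<dots> = (\<integral>\<^sup>+x. h x * q x \<partial>lborel)"
    by (rule layer_cake[symmetric]) measurable
  finally show ?thesis by (simp add: mult.commute)
qed

section \<open>Convolution\<close>

lemma ennreal_rearrangement:
  fixes a a' b b' :: ennreal
  assumes "a' \<le> a" "b' \<le> b"
  shows "a * b' + a' * b \<le> a * b + a' * b'"
proof -
  obtain c d where cd: "a = a' + c" "b = b' + d"
    using assms by (auto simp: le_iff_add)
  have "a * b + a' * b' = (a * b' + a' * b) + c * d"
    by (simp add: cd algebra_simps)
  then show ?thesis by simp
qed

lemma nn_integral_lborel_bisector_reflection:
  fixes e :: "'a::euclidean_space"
  assumes e: "norm e = 1" and [measurable]: "F \<in> borel_measurable borel"
  shows "(\<integral>\<^sup>+y. F (y - (2 * ((y - c) \<bullet> e)) *\<^sub>R e) \<partial>lborel) = (\<integral>\<^sup>+y. F y \<partial>lborel)"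
proof -
  have "(\<integral>\<^sup>+y. F (y - (2 * ((y - c) \<bullet> e)) *\<^sub>R e) \<partial>lborel) =
     (\<integral>\<^sup>+y. F (c + (y - (2 * (y \<bullet> e)) *\<^sub>R e)) \<partial>lborel)"
    using nn_integral_lborel_plus[of "\<lambda>y. F (y - (2 * ((y - c) \<bullet> e)) *\<^sub>R e)" c]
    by (simp add: add_diff_eq)
  also have "\<dots> = (\<integral>\<^sup>+y. F (c + y) \<partial>lborel)"
    by (rule nn_integral_lborel_hyperplane_reflection[OF e, of "\<lambda>y. F (c + y)"]) measurable
  finally show ?thesis by (simp add: nn_integral_lborel_plus)
qed

text \<open>
  Reflecting in the bisector of \<open>a\<close> and \<open>b\<close> exchanges the two translates of \<open>g\<close>. On each pair of
  mirror points the claim is the rearrangement inequality for two pairs of numbers, since the origin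
  lies on the side of \<open>a\<close> or on the bisector itself.
\<close>

lemma radial_decr_overlap:
  fixes f g :: "'a::euclidean_space \<Rightarrow> ennreal"
  assumes [measurable]: "f \<in> borel_measurable borel" "g \<in> borel_measurable borel"
    and f: "radial_decr f" and g: "radial_decr g" and ab: "norm a \<le> norm b"
  shows "(\<integral>\<^sup>+y. f y * g (y - b) \<partial>lborel) \<le> (\<integral>\<^sup>+y. f y * g (y - a) \<partial>lborel)"
proof (cases "a = b")
  case False
  define L where "L = norm (b - a)"
  define e where "e = (b - a) /\<^sub>R L"
  define c where "c = (a + b) /\<^sub>R 2"
  define \<sigma> where "\<sigma> y = y - (2 * ((y - c) \<bullet> e)) *\<^sub>R e" for y
  have L: "0 < L" using False by (simp add: L_def)
  have e: "norm e = 1" using L by (simp add: e_def L_def)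
  have ee: "e \<bullet> e = 1" using e by (simp add: norm_eq_1)
  have ba: "b = a + L *\<^sub>R e" using L by (simp add: e_def)
  have cc: "c = a + (L / 2) *\<^sub>R e" by (simp add: c_def ba algebra_simps flip: scaleR_add_left scaleR_2)
  have [measurable]: "\<sigma> \<in> borel_measurable borel" unfolding \<sigma>_def by measurable
  have ce: "0 \<le> c \<bullet> e"
  proof -
    have "0 \<le> b \<bullet> b - a \<bullet> a"
      using ab by (simp add: norm_le)
    also have "\<dots> = 2 * L * (c \<bullet> e)"
      by (simp add: ba cc inner_add_left inner_add_right ee inner_commute algebra_simps)
    finally show ?thesis using L by (simp add: zero_le_mult_iff)
  qed
  have sa: "norm (\<sigma> y - a) = norm (y - b)" and sb: "norm (\<sigma> y - b) = norm (y - a)" for y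
    unfolding norm_eq \<sigma>_def ba cc
    by (simp_all add: inner_add_left inner_add_right inner_diff_left inner_diff_right ee inner_commute algebra_simps)
  have s0: "(norm (\<sigma> y))\<^sup>2 = (norm y)\<^sup>2 - 4 * ((y - c) \<bullet> e) * (c \<bullet> e)" for y
    unfolding power2_norm_eq_inner \<sigma>_def
    by (simp add: inner_add_left inner_add_right inner_diff_left inner_diff_right ee inner_commute algebra_simps)
  have s1: "(norm (y - b))\<^sup>2 = (norm (y - a))\<^sup>2 - 2 * L * ((y - c) \<bullet> e)" for y
    unfolding power2_norm_eq_inner ba cc
    by (simp add: inner_add_left inner_add_right inner_diff_left inner_diff_right ee inner_commute algebra_simps)
  have pt: "f y * g (y - b) + f (\<sigma> y) * g (y - a) \<le> f y * g (y - a) + f (\<sigma> y) * g (y - b)" for y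
  proof (cases "(y - c) \<bullet> e \<le> 0")
    case True
    have "(norm y)\<^sup>2 \<le> (norm (\<sigma> y))\<^sup>2" "(norm (y - a))\<^sup>2 \<le> (norm (y - b))\<^sup>2"
      unfolding s0 s1 using True ce L by (simp_all add: mult_nonneg_nonpos mult_nonpos_nonneg)
    then have "f (\<sigma> y) \<le> f y" "g (y - b) \<le> g (y - a)"
      by (auto intro!: radial_decrD[OF f] radial_decrD[OF g])
    then show ?thesis by (rule ennreal_rearrangement)
  next
    case False
    have "(norm (\<sigma> y))\<^sup>2 \<le> (norm y)\<^sup>2" "(norm (y - b))\<^sup>2 \<le> (norm (y - a))\<^sup>2"
      unfolding s0 s1 using False ce L by simp_all
    then have "f y \<le> f (\<sigma> y)" "g (y - a) \<le> g (y - b)"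
      by (auto intro!: radial_decrD[OF f] radial_decrD[OF g])
    from ennreal_rearrangement[OF this] show ?thesis by (simp add: add.commute)
  qed
  have invariant: "(\<integral>\<^sup>+y. F (\<sigma> y) \<partial>lborel) = (\<integral>\<^sup>+y. F y \<partial>lborel)" if "F \<in> borel_measurable borel" for F :: "'a \<Rightarrow> ennreal"
    unfolding \<sigma>_def using nn_integral_lborel_bisector_reflection[OF e that] .
  have dbl: "2 * (\<integral>\<^sup>+y. f y * g (y - z) \<partial>lborel) = (\<integral>\<^sup>+y. f y * g (y - z) + f (\<sigma> y) * g (\<sigma> y - z) \<partial>lborel)" for z
    using invariant[of "\<lambda>y. f y * g (y - z)"] by (simp add: nn_integral_add mult_2)
  have "2 * (\<integral>\<^sup>+y. f y * g (y - b) \<partial>lborel) \<le> 2 * (\<integral>\<^sup>+y. f y * g (y - a) \<partial>lborel)"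
    unfolding dbl radial_decr_cong[OF g sa] radial_decr_cong[OF g sb]
    by (intro nn_integral_mono pt)
  then show ?thesis
    by (subst (asm) ennreal_mult_le_mult_iff) auto
qed simp

lemma radial_decr_correlation:
  fixes f g :: "'a::euclidean_space \<Rightarrow> ennreal"
  assumes "f \<in> borel_measurable borel" "g \<in> borel_measurable borel" "radial_decr f" "radial_decr g"
  shows "radial_decr (\<lambda>x. \<integral>\<^sup>+y. f y * g (x + y) \<partial>lborel)"
  unfolding radial_decr_def
proof (intro allI impI)
  fix x y :: 'a assume "norm x \<le> norm y"
  then show "(\<integral>\<^sup>+z. f z * g (y + z) \<partial>lborel) \<le> (\<integral>\<^sup>+z. f z * g (x + z) \<partial>lborel)"
    using radial_decr_overlap[OF assms, of "-x" "-y"] by (simp add: add.commute)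
qed

lemma radial_decr_indicator_rearr: "radial_decr (indicator (rearr D))"
  by (auto simp: radial_decr_def rearr_def split: split_indicator)

text \<open>
  Convolution of nonnegative functions with respect to Lebesgue measure.
\<close>

definition conv :: "('a::euclidean_space \<Rightarrow> ennreal) \<Rightarrow> ('a \<Rightarrow> ennreal) \<Rightarrow> 'a \<Rightarrow> ennreal" where
  "conv f g z = (\<integral>\<^sup>+x. f x * g (z - x) \<partial>lborel)"

lemma measurable_conv [measurable]:
  assumes [measurable]: "f \<in> borel_measurable borel" "g \<in> borel_measurable borel"
  shows "conv f g \<in> borel_measurable borel"
  unfolding conv_def by measurable

lemma radial_decr_conv:
  fixes f g :: "'a::euclidean_space \<Rightarrow> ennreal"
  assumes "f \<in> borel_measurable borel" "g \<in> borel_measurable borel" "radial_decr f" "radial_decr g"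
  shows "radial_decr (conv f g)"
proof -
  have "g (z - x) = g (x - z)" for z x
    by (rule radial_decr_cong[OF assms(4)]) (rule norm_minus_commute)
  then show ?thesis
    using radial_decr_overlap[OF assms] by (simp add: radial_decr_def conv_def)
qed

lemma nn_integral_conv:
  fixes f g :: "'a::euclidean_space \<Rightarrow> ennreal"
  assumes [measurable]: "f \<in> borel_measurable borel" "g \<in> borel_measurable borel" "C \<in> sets borel"
  shows "(\<integral>\<^sup>+z\<in>C. conv f g z \<partial>lborel) = (\<integral>\<^sup>+x. f x * (\<integral>\<^sup>+y. g y * indicator C (x + y) \<partial>lborel) \<partial>lborel)"
proof -
  have "(\<integral>\<^sup>+z\<in>C. conv f g z \<partial>lborel) = (\<integral>\<^sup>+z. \<integral>\<^sup>+x. f x * (g (z - x) * indicator C z) \<partial>lborel \<partial>lborel)"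
    by (simp add: conv_def nn_integral_multc[symmetric] mult.assoc)
  also have "\<dots> = (\<integral>\<^sup>+x. \<integral>\<^sup>+z. f x * (g (z - x) * indicator C z) \<partial>lborel \<partial>lborel)"
    by (rule lborel_pair.Fubini') measurable
  also have "\<dots> = (\<integral>\<^sup>+x. f x * (\<integral>\<^sup>+y. g y * indicator C (x + y) \<partial>lborel) \<partial>lborel)"
  proof (rule nn_integral_cong)
    fix x
    show "(\<integral>\<^sup>+z. f x * (g (z - x) * indicator C z) \<partial>lborel) = f x * (\<integral>\<^sup>+y. g y * indicator C (x + y) \<partial>lborel)"
      using nn_integral_lborel_plus[of "\<lambda>z. g (z - x) * indicator C z" x] by (simp add: nn_integral_cmult)
  qed
  finally show ?thesis .
qed

lemma integral_correlation:
  fixes p :: "'a::euclidean_space \<Rightarrow> ennreal"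
  assumes [measurable]: "p \<in> borel_measurable borel" "C \<in> sets borel"
  shows "(\<integral>\<^sup>+x. (\<integral>\<^sup>+y. p y * indicator C (x + y) \<partial>lborel) \<partial>lborel) = (\<integral>\<^sup>+y. p y \<partial>lborel) * emeasure lborel C"
proof -
  have "(\<integral>\<^sup>+x. (\<integral>\<^sup>+y. p y * indicator C (x + y) \<partial>lborel) \<partial>lborel) =
    (\<integral>\<^sup>+y. (\<integral>\<^sup>+x. p y * indicator C (x + y) \<partial>lborel) \<partial>lborel)"
    by (rule lborel_pair.Fubini') measurable
  also have "\<dots> = (\<integral>\<^sup>+y. p y * emeasure lborel C \<partial>lborel)"
  proof (rule nn_integral_cong)
    fix y
    show "(\<integral>\<^sup>+x. p y * indicator C (x + y) \<partial>lborel) = p y * emeasure lborel C"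
      using nn_integral_lborel_plus[of "indicator C" y] by (simp add: nn_integral_cmult add.commute)
  qed
  finally show ?thesis by (simp add: nn_integral_multc)
qed

lemma restricted_correlation:
  fixes p :: "'a::euclidean_space \<Rightarrow> ennreal"
  assumes [measurable]: "p \<in> borel_measurable borel" "C \<in> sets borel" "D \<in> sets borel"
  shows "(\<integral>\<^sup>+x\<in>D. (\<integral>\<^sup>+y. p y * indicator C (x + y) \<partial>lborel) \<partial>lborel) =
    (\<integral>\<^sup>+y. p y * (\<integral>\<^sup>+x. indicator D x * indicator C (y + x) \<partial>lborel) \<partial>lborel)"
proof -
  have "(\<integral>\<^sup>+x\<in>D. (\<integral>\<^sup>+y. p y * indicator C (x + y) \<partial>lborel) \<partial>lborel) =
    (\<integral>\<^sup>+x. \<integral>\<^sup>+y. p y * (indicator D x * indicator C (y + x)) \<partial>lborel \<partial>lborel)"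
  proof (rule nn_integral_cong)
    fix x
    show "(\<integral>\<^sup>+y. p y * indicator C (x + y) \<partial>lborel) * indicator D x =
      (\<integral>\<^sup>+y. p y * (indicator D x * indicator C (y + x)) \<partial>lborel)"
      by (subst nn_integral_multc[symmetric]) (auto simp: ac_simps)
  qed
  also have "\<dots> = (\<integral>\<^sup>+y. \<integral>\<^sup>+x. p y * (indicator D x * indicator C (y + x)) \<partial>lborel \<partial>lborel)"
    by (rule lborel_pair.Fubini') measurable
  finally show ?thesis by (simp add: nn_integral_cmult)
qed

text \<open>
  This is the Riesz inequality, read as a comparison of functions of the first variable.
\<close>

lemma less_spread_set_correlation:
  fixes C D :: "'a::euclidean_space set"
  assumes [measurable]: "C \<in> sets borel" "D \<in> sets borel"
    and "emeasure lborel C < \<infinity>" "emeasure lborel D < \<infinity>"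
  shows "less_spread (\<lambda>y. \<integral>\<^sup>+x. indicator D x * indicator C (y + x) \<partial>lborel)
     (\<lambda>y. \<integral>\<^sup>+x. indicator (rearr D) x * indicator (rearr C) (y + x) \<partial>lborel)"
  unfolding less_spread_def
proof (intro allI impI)
  fix E :: "'a set" assume [measurable]: "E \<in> sets borel" and E: "emeasure lborel E < \<infinity>"
  have eq: "(\<integral>\<^sup>+y\<in>E. (\<integral>\<^sup>+x. indicator D x * indicator C (y + x) \<partial>lborel) \<partial>lborel) = riesz_form E D C"
    if [measurable]: "C \<in> sets borel" "D \<in> sets borel" "E \<in> sets borel" for C D E :: "'a set"
    unfolding riesz_form_def
  proof (rule nn_integral_cong)
    fix y
    show "(\<integral>\<^sup>+x. indicator D x * indicator C (y + x) \<partial>lborel) * indicator E y =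
      (\<integral>\<^sup>+x. indicator E y * indicator D x * indicator C (y + x) \<partial>lborel)"
      by (subst nn_integral_multc[symmetric]) (auto simp: ac_simps)
  qed
  show "(\<integral>\<^sup>+y\<in>E. (\<integral>\<^sup>+x. indicator D x * indicator C (y + x) \<partial>lborel) \<partial>lborel) \<le>
    (\<integral>\<^sup>+y\<in>rearr E. (\<integral>\<^sup>+x. indicator (rearr D) x * indicator (rearr C) (y + x) \<partial>lborel) \<partial>lborel)"
    using riesz_rearrangement[of E D C] assms E by (simp only: eq[of C D E] eq[of "rearr C" "rearr D" "rearr E"] sets_rearr \<open>E \<in> sets borel\<close>)
qed

lemma less_spread_correlation:
  fixes p q :: "'a::euclidean_space \<Rightarrow> ennreal"
  assumes [measurable]: "p \<in> borel_measurable borel" "q \<in> borel_measurable borel" "C \<in> sets borel"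
    and pq: "less_spread p q" and q: "radial_decr q" "(\<integral>\<^sup>+x. q x \<partial>lborel) < \<infinity>"
    and C: "emeasure lborel C < \<infinity>"
  shows "less_spread (\<lambda>x. \<integral>\<^sup>+y. p y * indicator C (x + y) \<partial>lborel)
    (\<lambda>x. \<integral>\<^sup>+y. q y * indicator (rearr C) (x + y) \<partial>lborel)"
  unfolding less_spread_def
proof (intro allI impI)
  fix D :: "'a set" assume [measurable]: "D \<in> sets borel" and D: "emeasure lborel D < \<infinity>"
  show "(\<integral>\<^sup>+x\<in>D. (\<integral>\<^sup>+y. p y * indicator C (x + y) \<partial>lborel) \<partial>lborel) \<le>
    (\<integral>\<^sup>+x\<in>rearr D. (\<integral>\<^sup>+y. q y * indicator (rearr C) (x + y) \<partial>lborel) \<partial>lborel)"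
    unfolding restricted_correlation[OF assms(1,3) \<open>D \<in> sets borel\<close>]
      restricted_correlation[OF assms(2) sets_rearr sets_rearr]
  proof (rule less_spread_pairing)
    show "(\<integral>\<^sup>+y. (\<integral>\<^sup>+x. indicator D x * indicator C (y + x) \<partial>lborel) \<partial>lborel) < \<infinity>"
      using integral_correlation[of "indicator D" C] C D by (simp add: ennreal_mult_less_top)
    show "radial_decr (\<lambda>y. \<integral>\<^sup>+x. indicator (rearr D) x * indicator (rearr C) (y + x) \<partial>lborel)"
      by (intro radial_decr_correlation radial_decr_indicator_rearr) measurable
    show "less_spread (\<lambda>y. \<integral>\<^sup>+x. indicator D x * indicator C (y + x) \<partial>lborel)
     (\<lambda>y. \<integral>\<^sup>+x. indicator (rearr D) x * indicator (rearr C) (y + x) \<partial>lborel)"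
      by (intro less_spread_set_correlation C D) measurable
  qed (use pq q in simp_all)
qed

theorem less_spread_conv:
  fixes p1 p2 q1 q2 :: "'a::euclidean_space \<Rightarrow> ennreal"
  assumes [measurable]: "p1 \<in> borel_measurable borel" "q1 \<in> borel_measurable borel"
      "p2 \<in> borel_measurable borel" "q2 \<in> borel_measurable borel"
    and ls: "less_spread p1 q1" "less_spread p2 q2"
    and q: "radial_decr q1" "radial_decr q2"
    and fin: "(\<integral>\<^sup>+x. q1 x \<partial>lborel) < \<infinity>" "(\<integral>\<^sup>+x. p2 x \<partial>lborel) < \<infinity>" "(\<integral>\<^sup>+x. q2 x \<partial>lborel) < \<infinity>"
  shows "less_spread (conv p1 p2) (conv q1 q2)"
  unfolding less_spread_def
proof (intro allI impI)
  fix C :: "'a set" assume C [measurable]: "C \<in> sets borel" and Cf: "emeasure lborel C < \<infinity>"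
  show "(\<integral>\<^sup>+z\<in>C. conv p1 p2 z \<partial>lborel) \<le> (\<integral>\<^sup>+z\<in>rearr C. conv q1 q2 z \<partial>lborel)"
    unfolding nn_integral_conv[OF assms(1,3) C] nn_integral_conv[OF assms(2,4) sets_rearr]
  proof (rule less_spread_pairing)
    show "less_spread (\<lambda>x. \<integral>\<^sup>+y. p2 y * indicator C (x + y) \<partial>lborel)
      (\<lambda>x. \<integral>\<^sup>+y. q2 y * indicator (rearr C) (x + y) \<partial>lborel)"
      by (intro less_spread_correlation ls q fin Cf) measurable
    show "(\<integral>\<^sup>+x. (\<integral>\<^sup>+y. p2 y * indicator C (x + y) \<partial>lborel) \<partial>lborel) < \<infinity>"
      using integral_correlation[of p2 C] fin Cf by (simp add: ennreal_mult_less_top)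
    show "radial_decr (\<lambda>x. \<integral>\<^sup>+y. q2 y * indicator (rearr C) (x + y) \<partial>lborel)"
      by (intro radial_decr_correlation radial_decr_indicator_rearr q) measurable
  qed (use ls q fin in simp_all)
qed

lemma less_spread_bounded:
  fixes p :: "'a::euclidean_space \<Rightarrow> ennreal"
  assumes [measurable]: "p \<in> borel_measurable borel" and p: "(\<integral>\<^sup>+x. p x \<partial>lborel) \<le> 1"
    and K: "AE x in lborel. p x \<le> ennreal K"
    and u: "ennreal K * emeasure lborel (ball (0::'a) r) = 1"
  shows "less_spread p (\<lambda>x. ennreal K * indicator (ball 0 r) x)"
  unfolding less_spread_def
proof (intro allI impI)
  fix D :: "'a set" assume [measurable]: "D \<in> sets borel" and D: "emeasure lborel D < \<infinity>"
  obtain r' where r': "rearr D = ball 0 r'" by (auto simp: rearr_def)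
  have 1: "(\<integral>\<^sup>+x\<in>D. p x \<partial>lborel) \<le> ennreal K * emeasure lborel (rearr D)"
  proof -
    have "(\<integral>\<^sup>+x\<in>D. p x \<partial>lborel) \<le> (\<integral>\<^sup>+x\<in>D. ennreal K \<partial>lborel)"
      using K by (intro nn_integral_mono_AE) (auto split: split_indicator elim!: eventually_mono)
    then show ?thesis using emeasure_rearr[OF D] by (simp add: nn_integral_cmult_indicator)
  qed
  have 2: "(\<integral>\<^sup>+x\<in>D. p x \<partial>lborel) \<le> ennreal K * emeasure lborel (ball (0::'a) r)"
  proof -
    have "(\<integral>\<^sup>+x\<in>D. p x \<partial>lborel) \<le> (\<integral>\<^sup>+x. p x \<partial>lborel)"
      by (intro nn_integral_mono) (auto split: split_indicator)
    then show ?thesis using p u by simp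
  qed
  have "(\<integral>\<^sup>+x\<in>rearr D. ennreal K * indicator (ball 0 r) x \<partial>lborel) =
     ennreal K * emeasure lborel (ball 0 r \<inter> rearr D)"
    by (simp add: mult.assoc nn_integral_cmult_indicator indicator_inter_arith[symmetric])
  moreover have "ball 0 r \<inter> rearr D = rearr D \<or> ball 0 r \<inter> rearr D = ball (0::'a) r"
    unfolding r' by (cases "r \<le> r'") auto
  ultimately show "(\<integral>\<^sup>+x\<in>D. p x \<partial>lborel) \<le> (\<integral>\<^sup>+x\<in>rearr D. ennreal K * indicator (ball 0 r) x \<partial>lborel)"
    using 1 2 by auto
qed

lemma radial_decr_uniform: "radial_decr (\<lambda>x. c * indicator (ball 0 r) x)"
  by (auto simp: radial_decr_def split: split_indicator)

section \<open>Sums of independent random vectors\<close>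

lemma nn_integral_conv_UNIV:
  fixes f g :: "'a::euclidean_space \<Rightarrow> ennreal"
  assumes [measurable]: "f \<in> borel_measurable borel" "g \<in> borel_measurable borel"
  shows "(\<integral>\<^sup>+z. conv f g z \<partial>lborel) = (\<integral>\<^sup>+x. f x \<partial>lborel) * (\<integral>\<^sup>+x. g x \<partial>lborel)"
  using nn_integral_conv[of f g UNIV] by (simp add: nn_integral_multc)

lemma (in prob_space) distributed_add_conv:
  fixes X Y :: "'a \<Rightarrow> 'b::euclidean_space"
  assumes ind: "indep_var borel X borel Y"
    and X: "distributed M lborel X p" and Y: "distributed M lborel Y q"
  shows "distributed M lborel (\<lambda>\<omega>. X \<omega> + Y \<omega>) (conv p q)"
proof -
  have [measurable]: "X \<in> borel_measurable M" "Y \<in> borel_measurable M"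
    "p \<in> borel_measurable borel" "q \<in> borel_measurable borel"
    using X Y by (auto simp: distributed_def)
  have dX: "distr M borel X = density lborel p" and dY: "distr M borel Y = density lborel q"
    using X Y by (auto simp: distributed_def cong: distr_cong)
  interpret Y: prob_space "distr M borel Y" by (rule prob_space_distr) simp
  have "distr M lborel (\<lambda>\<omega>. X \<omega> + Y \<omega>) = density lborel (conv p q)"
  proof (rule measure_eqI)
    fix A assume "A \<in> sets (distr M lborel (\<lambda>\<omega>. X \<omega> + Y \<omega>))"
    then have [measurable]: "A \<in> sets borel" by simp
    have "emeasure (distr M lborel (\<lambda>\<omega>. X \<omega> + Y \<omega>)) A = (\<integral>\<^sup>+z. indicator A z \<partial>distr M lborel (\<lambda>\<omega>. X \<omega> + Y \<omega>))"
      by simp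
    also have "\<dots> = (\<integral>\<^sup>+\<omega>. indicator A (X \<omega> + Y \<omega>) \<partial>M)"
      by (rule nn_integral_distr) measurable
    also have "\<dots> = (\<integral>\<^sup>+z. indicator A (fst z + snd z) \<partial>distr M (borel \<Otimes>\<^sub>M borel) (\<lambda>\<omega>. (X \<omega>, Y \<omega>)))"
      by (subst nn_integral_distr) simp_all
    also have "distr M (borel \<Otimes>\<^sub>M borel) (\<lambda>\<omega>. (X \<omega>, Y \<omega>)) = distr M borel X \<Otimes>\<^sub>M distr M borel Y"
      using ind by (simp add: indep_var_distribution_eq)
    also have "(\<integral>\<^sup>+z. indicator A (fst z + snd z) \<partial>(distr M borel X \<Otimes>\<^sub>M distr M borel Y)) =
      (\<integral>\<^sup>+x. \<integral>\<^sup>+y. indicator A (x + y) \<partial>distr M borel Y \<partial>distr M borel X)"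
      by (subst Y.nn_integral_fst[symmetric]) simp_all
    also have "\<dots> = (\<integral>\<^sup>+x. p x * (\<integral>\<^sup>+y. q y * indicator A (x + y) \<partial>lborel) \<partial>lborel)"
      unfolding dX dY by (simp add: nn_integral_density)
    also have "\<dots> = (\<integral>\<^sup>+z\<in>A. conv p q z \<partial>lborel)"
      by (rule nn_integral_conv[symmetric]) measurable
    also have "\<dots> = emeasure (density lborel (conv p q)) A"
      by (simp add: emeasure_density)
    finally show "emeasure (distr M lborel (\<lambda>\<omega>. X \<omega> + Y \<omega>)) A = emeasure (density lborel (conv p q)) A" .
  qed simp
  then show ?thesis by (simp add: distributed_def)
qed

text \<open>
  \<open>conv_upto f m\<close> is the convolution of the \<open>m + 1\<close> functions \<open>f 1, \<dots>, f (m + 1)\<close>.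
\<close>

primrec conv_upto :: "(nat \<Rightarrow> 'a::euclidean_space \<Rightarrow> ennreal) \<Rightarrow> nat \<Rightarrow> 'a \<Rightarrow> ennreal" where
  "conv_upto f 0 = f 1"
| "conv_upto f (Suc m) = conv (f (Suc (Suc m))) (conv_upto f m)"

lemma (in prob_space) indep_var_add_last:
  fixes X :: "nat \<Rightarrow> 'a \<Rightarrow> 'b::euclidean_space"
  assumes indep: "indep_vars (\<lambda>_. borel) X {1..Suc m}"
  shows "indep_var borel (X (Suc m)) borel (\<lambda>\<omega>. \<Sum>i=1..m. X i \<omega>)"
proof -
  have "indep_var
    borel ((\<lambda>f. f (Suc m)) \<circ> (\<lambda>\<omega>. restrict (\<lambda>i. X i \<omega>) {Suc m}))
    borel ((\<lambda>f. \<Sum>i\<in>{1..m}. f i) \<circ> (\<lambda>\<omega>. restrict (\<lambda>i. X i \<omega>) {1..m}))"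
    by (intro indep_var_compose[OF indep_var_restrict[OF indep]]) auto
  also have "((\<lambda>f. f (Suc m)) \<circ> (\<lambda>\<omega>. restrict (\<lambda>i. X i \<omega>) {Suc m})) = X (Suc m)"
    by auto
  also have "((\<lambda>f. \<Sum>i\<in>{1..m}. f i) \<circ> (\<lambda>\<omega>. restrict (\<lambda>i. X i \<omega>) {1..m})) = (\<lambda>\<omega>. \<Sum>i=1..m. X i \<omega>)"
    by (auto cong: rev_conj_cong)
  finally show ?thesis .
qed

lemma (in prob_space) distributed_sum_conv_upto:
  fixes X :: "nat \<Rightarrow> 'a \<Rightarrow> 'b::euclidean_space"
  assumes "indep_vars (\<lambda>_. borel) X {1..Suc m}"
    and "\<And>i. i \<in> {1..Suc m} \<Longrightarrow> distributed M lborel (X i) (f i)"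
  shows "distributed M lborel (\<lambda>\<omega>. \<Sum>i=1..Suc m. X i \<omega>) (conv_upto f m)"
  using assms
proof (induction m)
  case (Suc m)
  have "distributed M lborel (\<lambda>\<omega>. \<Sum>i=1..Suc m. X i \<omega>) (conv_upto f m)"
    using Suc.prems indep_vars_subset[OF Suc.prems(1), of "{1..Suc m}"] by (intro Suc.IH) auto
  from distributed_add_conv[OF indep_var_add_last[OF Suc.prems(1)] Suc.prems(2) this]
  show ?case by (simp add: add.commute)
qed simp

lemma conv_upto_props:
  fixes f :: "nat \<Rightarrow> 'a::euclidean_space \<Rightarrow> ennreal"
  assumes "\<And>i. i \<in> {1..Suc m} \<Longrightarrow> f i \<in> borel_measurable borel"
    and "\<And>i. i \<in> {1..Suc m} \<Longrightarrow> (\<integral>\<^sup>+x. f i x \<partial>lborel) < \<infinity>"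
  shows "conv_upto f m \<in> borel_measurable borel \<and> (\<integral>\<^sup>+x. conv_upto f m x \<partial>lborel) < \<infinity>"
  using assms
proof (induction m)
  case (Suc m)
  have IH: "conv_upto f m \<in> borel_measurable borel" "(\<integral>\<^sup>+x. conv_upto f m x \<partial>lborel) < \<infinity>"
    using Suc by auto
  have "f (Suc (Suc m)) \<in> borel_measurable borel" "(\<integral>\<^sup>+x. f (Suc (Suc m)) x \<partial>lborel) < \<infinity>"
    using Suc.prems by auto
  with IH show ?case
    by (simp add: measurable_conv nn_integral_conv_UNIV ennreal_mult_less_top)
qed simp

lemma less_spread_conv_upto:
  fixes f g :: "nat \<Rightarrow> 'a::euclidean_space \<Rightarrow> ennreal"
  assumes meas: "\<And>i. i \<in> {1..Suc m} \<Longrightarrow> f i \<in> borel_measurable borel"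
      "\<And>i. i \<in> {1..Suc m} \<Longrightarrow> g i \<in> borel_measurable borel"
    and fin: "\<And>i. i \<in> {1..Suc m} \<Longrightarrow> (\<integral>\<^sup>+x. f i x \<partial>lborel) < \<infinity>"
      "\<And>i. i \<in> {1..Suc m} \<Longrightarrow> (\<integral>\<^sup>+x. g i x \<partial>lborel) < \<infinity>"
    and ls: "\<And>i. i \<in> {1..Suc m} \<Longrightarrow> less_spread (f i) (g i)"
    and g: "\<And>i. i \<in> {1..Suc m} \<Longrightarrow> radial_decr (g i)"
  shows "less_spread (conv_upto f m) (conv_upto g m) \<and> radial_decr (conv_upto g m)"
  using assms
proof (induction m)
  case (Suc m)
  have IH: "less_spread (conv_upto f m) (conv_upto g m)" "radial_decr (conv_upto g m)"
    using Suc by auto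
  have p: "conv_upto f m \<in> borel_measurable borel" "(\<integral>\<^sup>+x. conv_upto f m x \<partial>lborel) < \<infinity>"
    "conv_upto g m \<in> borel_measurable borel" "(\<integral>\<^sup>+x. conv_upto g m x \<partial>lborel) < \<infinity>"
    using conv_upto_props[of m f] conv_upto_props[of m g] Suc.prems by auto
  show ?case
    unfolding conv_upto.simps
    by (intro conjI less_spread_conv radial_decr_conv IH p Suc.prems) auto
qed simp

text \<open>
  If \<open>q \<le> e\<close> almost everywhere, then \<open>\<integral>\<^sub>C p \<le> e \<bar>C\<bar>\<close> for all \<open>C\<close> of finite volume, so \<open>p > e\<close> can
  only hold on a null set.
\<close>

lemma less_spread_levels:
  fixes p q :: "'a::euclidean_space \<Rightarrow> ennreal"
  assumes [measurable]: "p \<in> borel_measurable borel" "q \<in> borel_measurable borel"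
    and ls: "less_spread p q" and pos: "emeasure lborel {t. e < p t} > 0"
  shows "emeasure lborel {t. e < q t} > 0"
proof (rule ccontr)
  assume "\<not> ?thesis"
  then have q: "AE t in lborel. q t \<le> e"
    by (subst AE_iff_measurable[of "{t. e < q t}"]) (auto simp: not_le)
  have "{t. e < p t} \<noteq> {}" using pos by (metis emeasure_empty less_irrefl)
  then have e: "e < \<infinity>" by (auto intro: less_le_trans)
  have "\<exists>n. emeasure lborel ({t. e < p t} \<inter> ball 0 (real n)) > 0"
  proof (rule ccontr)
    assume "\<not> ?thesis"
    then have "emeasure lborel (\<Union>n. {t. e < p t} \<inter> ball 0 (real n)) = 0"
      by (intro emeasure_UN_eq_0) (auto simp: not_less)
    moreover have "(\<Union>n. {t. e < p t} \<inter> ball 0 (real n)) = {t. e < p t}"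
      using reals_Archimedean2 by auto
    ultimately show False using pos by simp
  qed
  then obtain n where n: "emeasure lborel ({t. e < p t} \<inter> ball 0 (real n)) > 0" by auto
  define C where "C = {t. e < p t} \<inter> ball 0 (real n)"
  have [measurable]: "C \<in> sets borel" unfolding C_def by measurable
  have C: "emeasure lborel C < \<infinity>"
    unfolding C_def by (rule finite_emeasure_subset_ball[of _ "real n"]) auto
  have "e * emeasure lborel C + (\<integral>\<^sup>+t\<in>C. p t - e \<partial>lborel) = (\<integral>\<^sup>+t. e * indicator C t + (p t - e) * indicator C t \<partial>lborel)"
    by (simp add: nn_integral_add nn_integral_cmult_indicator)
  also have "\<dots> = (\<integral>\<^sup>+t\<in>C. p t \<partial>lborel)"
    by (intro nn_integral_cong) (auto simp: C_def add_diff_self_ennreal split: split_indicator)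
  also have "\<dots> \<le> (\<integral>\<^sup>+t\<in>rearr C. q t \<partial>lborel)"
    using ls C by (simp add: less_spread_def)
  also have "\<dots> \<le> (\<integral>\<^sup>+t\<in>rearr C. e \<partial>lborel)"
    using q by (intro nn_integral_mono_AE) (auto split: split_indicator elim!: eventually_mono)
  also have "\<dots> = e * emeasure lborel C + 0"
    using emeasure_rearr[OF C] by (simp add: nn_integral_cmult_indicator)
  finally have "(\<integral>\<^sup>+t\<in>C. p t - e \<partial>lborel) = 0"
    using e C by (auto simp: ennreal_mult_eq_top_iff)
  then have "AE t in lborel. (p t - e) * indicator C t = 0"
    by (subst (asm) nn_integral_0_iff_AE) auto
  then have "AE t in lborel. t \<notin> C"
    by (rule eventually_mono) (auto simp: C_def diff_eq_0_iff_ennreal split: split_indicator_asm)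
  then have "emeasure lborel C = 0"
    by (subst (asm) AE_iff_measurable[of C]) auto
  then show False using n by (simp add: C_def)
qed

lemma (in prob_space) density_of_ess_sup_density_le:
  fixes X :: "'a \<Rightarrow> 'b::euclidean_space"
  assumes [measurable]: "X \<in> borel_measurable M" and le: "ess_sup_density M X \<le> ennreal K"
  shows "\<exists>p. distributed M lborel X p \<and> (AE x in lborel. p x \<le> ennreal K)"
proof -
  let ?p = "RN_deriv lborel (distr M borel X)"
  have ac: "absolutely_continuous lborel (distr M borel X)"
    using le by (auto simp: ess_sup_density_def top_unique split: if_splits)
  have "density lborel ?p = distr M borel X"
    by (rule sigma_finite_measure.density_RN_deriv[OF lborel.sigma_finite_measure_axioms ac]) simp
  then have d: "distributed M lborel X ?p"
    by (auto simp: distributed_def cong: distr_cong)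
  have "esssup lborel ?p \<le> ennreal K"
    using le ac by (simp add: ess_sup_density_def Sup_levels_eq_esssup)
  moreover have "AE x in lborel. ?p x \<le> esssup lborel ?p"
    by (rule esssup_AE)
  ultimately have "AE x in lborel. ?p x \<le> ennreal K"
    by (auto elim!: eventually_mono intro: order_trans)
  with d show ?thesis by blast
qed

lemma (in prob_space) distributed_integral:
  assumes "distributed M lborel X p"
  shows "(\<integral>\<^sup>+x. p x \<partial>lborel) = 1"
  using distributed_emeasure[OF assms, of UNIV] measurable_space[OF distributed_measurable[OF assms]]
  by (simp add: emeasure_space_1)

theorem corollary1:
  fixes n :: nat
    and K r :: "nat \<Rightarrow> real"
    and P :: "'a measure" and X :: "nat \<Rightarrow> 'a \<Rightarrow> real ^ 'd::finite"
    and Q :: "'b measure" and U :: "nat \<Rightarrow> 'b \<Rightarrow> real ^ 'd::finite"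
  assumes "n \<ge> 1"
    and "\<And>i. i \<in> {1..n} \<Longrightarrow> K i > 0"
    and "prob_space P"
    and "prob_space.indep_vars P (\<lambda>_. borel) X {1..n}"
    and "\<And>i. i \<in> {1..n} \<Longrightarrow> ess_sup_density P (X i) \<le> ennreal (K i)"
    and "prob_space Q"
    and "prob_space.indep_vars Q (\<lambda>_. borel) U {1..n}"
    and "\<And>i. i \<in> {1..n} \<Longrightarrow>
      distributed Q lborel (U i) (\<lambda>t. if t \<in> ball 0 (r i) then ennreal (K i) else 0)"
  shows "ess_sup_density P (\<lambda>\<omega>. \<Sum>i=1..n. X i \<omega>) \<le> ess_sup_density Q (\<lambda>\<omega>. \<Sum>i=1..n. U i \<omega>)"
proof -
  interpret P: prob_space P by fact
  interpret Q: prob_space Q by fact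
  obtain m where n: "n = Suc m" using assms(1) by (cases n) auto
  have X: "X i \<in> borel_measurable P" if "i \<in> {1..n}" for i
    using assms(4) that by (auto simp: P.indep_vars_def)
  have "\<exists>p. distributed P lborel (X i) p \<and> (AE x in lborel. p x \<le> ennreal (K i))" if "i \<in> {1..n}" for i
    using P.density_of_ess_sup_density_le[OF X[OF that] assms(5)[OF that]] .
  then obtain p where p: "distributed P lborel (X i) (p i)" "AE x in lborel. p i x \<le> ennreal (K i)"
    if "i \<in> {1..n}" for i
    by metis
  define u where "u i t = ennreal (K i) * indicator (ball 0 (r i)) t" for i and t :: "real ^ 'd"
  have "u i = (\<lambda>t. if t \<in> ball 0 (r i) then ennreal (K i) else 0)" for i
    by (auto simp: u_def split: split_indicator)
  then have u: "distributed Q lborel (U i) (u i)" if "i \<in> {1..n}" for i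
    using assms(8)[OF that] by simp
  have int: "(\<integral>\<^sup>+x. p i x \<partial>lborel) = 1" "(\<integral>\<^sup>+x. u i x \<partial>lborel) = 1" if "i \<in> {1..n}" for i
    using P.distributed_integral[OF p(1)[OF that]] Q.distributed_integral[OF u[OF that]] by auto
  have meas: "p i \<in> borel_measurable borel" "u i \<in> borel_measurable borel" if "i \<in> {1..n}" for i
    using p(1)[OF that] u[OF that] by (auto simp: distributed_def)
  have ls: "less_spread (p i) (u i)" if "i \<in> {1..n}" for i
    unfolding u_def
  proof (rule less_spread_bounded)
    show "ennreal (K i) * emeasure lborel (ball (0::real ^ 'd) (r i)) = 1"
      using int(2)[OF that] by (simp add: u_def nn_integral_cmult_indicator)
  qed (use that p int meas in auto)
  have dX: "distributed P lborel (\<lambda>\<omega>. \<Sum>i=1..n. X i \<omega>) (conv_upto p m)"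
    using assms(4) p(1) unfolding n by (intro P.distributed_sum_conv_upto) auto
  have dU: "distributed Q lborel (\<lambda>\<omega>. \<Sum>i=1..n. U i \<omega>) (conv_upto u m)"
    using assms(7) u unfolding n by (intro Q.distributed_sum_conv_upto) auto
  have "less_spread (conv_upto p m) (conv_upto u m) \<and> radial_decr (conv_upto u m)"
    using meas int ls unfolding n
    by (intro less_spread_conv_upto) (auto simp: u_def[abs_def] radial_decr_uniform)
  then have "{e. emeasure lborel {t. e < conv_upto p m t} > 0} \<subseteq> {e. emeasure lborel {t. e < conv_upto u m t} > 0}"
    using less_spread_levels[of "conv_upto p m" "conv_upto u m"] dX dU by (auto simp: distributed_def)
  then show ?thesis
    unfolding ess_sup_density_eq[OF dX] ess_sup_density_eq[OF dU] by (rule Sup_subset_mono)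
qed

end
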